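(* Let $n,k\ge 1$ be integers and let $\lambda$ be a partition of $n$ with $\ell(\lambda)<n+1-k$. Then $$p_k^{\lambda}(n)=\frac{\sum_{i\geq 1}\binom{k+2i}{k-1}\,p_{k+2i}^{\lambda}(n)\, q^{\lambda}+\sum_{i\geq 1}\ \sum_{\mu\rhd_{2i+1}\lambda}\kappa_{\mu,\lambda}\,p_k^{\mu}(n)\, q^{\mu}}{q^{\lambda}\,[n+1-k-\ell(\lambda)]}.$$
   Context: Permutations of $[n]=\{1,\dots,n\}$ are composed as maps (right to left). A plane permutation on $[n]$ is a pair $\mathfrak p=(s,\pi)$ with $s$ an $n$-cycle and $\pi$ an arbitrary permutation of $[n]$; its diagonal is $D_{\mathfrak p}=s\pi^{-1}$. For a partition $\lambda$ of $n$, $\ell(\lambda)$ is its number of parts and $q^\lambda$ is the number of permutations of $[n]$ of cycle-type $\lambda$. For a fixed permutation $D$ of $[n]$ of cycle-type $\lambda$, $p_k^\lambda(n)$ is the number of plane permutations $(s,\pi)$ on $[n]$ with diagonal $D$ such that $\pi$ has exactly $k$ cycles (this depends only on $\lambda$, not on the choice of $D$). For partitions $\mu,\lambda$ of $n$, $\mu\rhd_{2i+1}\lambda$ means that $\mu$ can be obtained from $\lambda$ by splitting one part of $\lambda$ into $2i+1$ non-zero parts, and $\kappa_{\mu,\lambda}$ is the number of ways to obtain $\lambda$ from $\mu$ by merging $\ell(\mu)-\ell(\lambda)+1$ parts of $\mu$ into one, where the parts of $\mu$ are regarded as distinguishable (so one counts the subsets of $\ell(\mu)-\ell(\lambda)+1$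 parts of $\mu$ whose merging gives $\lambda$). *)

theory Defs
  imports "HOL-Combinatorics.Orbits" "HOL-Combinatorics.Cycles" "HOL-Analysis.Infinite_Sum"
begin

section \<open>Partitions of a natural number\<close>

definition number_partitions :: "nat \<Rightarrow> nat multiset set" where
  "number_partitions n = {l. sum_mset l = n \<and> 0 \<notin># l}"

text \<open>\<open>splits_part j m l\<close>: the partition \<open>m\<close> arises from \<open>l\<close> by splitting one part of \<open>l\<close>
  into \<open>j\<close> non-zero parts.\<close>

definition splits_part :: "nat \<Rightarrow> nat multiset \<Rightarrow> nat multiset \<Rightarrow> bool" where
  "splits_part j m l \<longleftrightarrow>
     (\<exists>a v. a \<in># l \<and> size v = j \<and> 0 \<notin># v \<and> sum_mset v = a \<and> m = (l - {#a#}) + v)"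

text \<open>To regard the parts of \<open>m\<close> as distinguishable, we list them and identify a part with its
  position in the list; \<open>merge_parts xs I\<close> merges the parts at the positions in \<open>I\<close> into one.
  The cardinality condition in \<open>kappa\<close> is \<open>card I = size m - size l + 1\<close>, stated
  without truncated subtraction.\<close>

definition merge_parts :: "nat list \<Rightarrow> nat set \<Rightarrow> nat multiset" where
  "merge_parts xs I =
     add_mset (\<Sum>i\<in>I. xs ! i) (image_mset (\<lambda>i. xs ! i) (mset_set ({..<length xs} - I)))"

definition kappa :: "nat multiset \<Rightarrow> nat multiset \<Rightarrow> nat" where
  "kappa m l = (let xs = sorted_list_of_multiset m in
     card {I. I \<subseteq> {..<length xs} \<and> card I + size l = size m + 1 \<and> merge_parts xs I = l})"

lemma finite_number_partitions: "finite (number_partitions n)"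
proof (rule finite_subset)
  show "number_partitions n \<subseteq> mset ` {xs. set xs \<subseteq> {..n} \<and> length xs \<le> n}"
  proof
    fix l assume "l \<in> number_partitions n"
    then have s: "sum_mset l = n" and z: "0 \<notin># l" by (auto simp: number_partitions_def)
    obtain xs where xs: "l = mset xs" by (metis ex_mset)
    have "set xs \<subseteq> {..n}"
      using s unfolding xs by (auto simp: sum_mset_sum_list intro: member_le_sum_list)
    moreover have "length xs \<le> sum_list xs"
      using z unfolding xs by (induction xs) auto
    ultimately show "l \<in> mset ` {xs. set xs \<subseteq> {..n} \<and> length xs \<le> n}"
      using s xs by (auto simp: sum_mset_sum_list)
  qed
  show "finite (mset ` {xs. set xs \<subseteq> {..n} \<and> length xs \<le> n})"
    by (intro finite_imageI finite_lists_length_le) auto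
qed

section \<open>Cycles and plane permutations\<close>

text \<open>A cycle is represented by its support, so fixed points count as cycles of length one.\<close>

definition cycles_of :: "nat \<Rightarrow> (nat \<Rightarrow> nat) \<Rightarrow> nat set set" where
  "cycles_of n f = orbit f ` {1..n}"

definition cycle_type :: "nat \<Rightarrow> (nat \<Rightarrow> nat) \<Rightarrow> nat multiset" where
  "cycle_type n f = image_mset card (mset_set (cycles_of n f))"

definition perms_of_type :: "nat \<Rightarrow> nat multiset \<Rightarrow> (nat \<Rightarrow> nat) set" where
  "perms_of_type n l = {f. f permutes {1..n} \<and> cycle_type n f = l}"

definition cycle_type_count :: "nat \<Rightarrow> nat multiset \<Rightarrow> nat" where
  "cycle_type_count n l = card (perms_of_type n l)"

definition plane_permutations :: "nat \<Rightarrow> ((nat \<Rightarrow> nat) \<times> (nat \<Rightarrow> nat)) set" where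
  "plane_permutations n =
     {(s, p). s permutes {1..n} \<and> cyclic_on s {1..n} \<and> p permutes {1..n}}"

definition diagonal :: "(nat \<Rightarrow> nat) \<times> (nat \<Rightarrow> nat) \<Rightarrow> (nat \<Rightarrow> nat)" where
  "diagonal P = fst P \<circ> inv (snd P)"

definition diagonal_count :: "nat \<Rightarrow> nat \<Rightarrow> (nat \<Rightarrow> nat) \<Rightarrow> nat" where
  "diagonal_count n k D =
     card {P \<in> plane_permutations n. diagonal P = D \<and> card (cycles_of n (snd P)) = k}"

text \<open>The diagonal is fixed by choosing an arbitrary permutation of the given cycle type; by
  \<open>plane_count_eq\<close> and \<open>perms_of_type_nonempty\<close> below, one exists and the choice is irrelevant.\<close>

definition plane_count :: "nat \<Rightarrow> nat \<Rightarrow> nat multiset \<Rightarrow> nat" where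
  "plane_count n k l = diagonal_count n k (SOME D. D \<in> perms_of_type n l)"

section \<open>Independence of the choice of the diagonal\<close>

lemma orbit_conj_bij:
  assumes "bij \<sigma>"
  shows "orbit (\<sigma> \<circ> f \<circ> inv \<sigma>) (\<sigma> x) = \<sigma> ` orbit f x"
proof -
  have "((\<sigma> \<circ> f \<circ> inv \<sigma>) ^^ m) (\<sigma> x) = \<sigma> ((f ^^ m) x)" for m
    using assms by (induction m) (simp_all add: bij_is_inj)
  then show ?thesis by (auto simp: orbit_altdef)
qed

lemma cycles_of_conj:
  assumes "\<sigma> permutes {1..n}"
  shows "cycles_of n (\<sigma> \<circ> f \<circ> inv \<sigma>) = (`) \<sigma> ` cycles_of n f"
proof -
  have "cycles_of n (\<sigma> \<circ> f \<circ> inv \<sigma>) = orbit (\<sigma> \<circ> f \<circ> inv \<sigma>) ` \<sigma> ` {1..n}"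
    using assms by (simp add: cycles_of_def permutes_image)
  also have "\<dots> = (`) \<sigma> ` cycles_of n f"
    using orbit_conj_bij[OF permutes_bij[OF assms]] by (auto simp: cycles_of_def image_image)
  finally show ?thesis .
qed

lemma card_cycles_of_conj:
  assumes "\<sigma> permutes {1..n}"
  shows "card (cycles_of n (\<sigma> \<circ> f \<circ> inv \<sigma>)) = card (cycles_of n f)"
  unfolding cycles_of_conj[OF assms]
  by (intro card_image inj_on_image inj_on_subset[OF permutes_inj[OF assms]]) auto

lemma diagonal_count_conj_le:
  assumes \<sigma>: "\<sigma> permutes {1..n}"
  shows "diagonal_count n k D \<le> diagonal_count n k (\<sigma> \<circ> D \<circ> inv \<sigma>)"
proof -
  let ?c = "\<lambda>f. \<sigma> \<circ> f \<circ> inv \<sigma>"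
  have bij: "bij \<sigma>" and isig: "inv \<sigma> permutes {1..n}" using \<sigma> by (auto intro: permutes_bij permutes_inv)
  have perm: "?c f permutes {1..n}" if "f permutes {1..n}" for f
    using that \<sigma> isig by (intro permutes_compose) auto
  have inj_c: "f = g" if "?c f = ?c g" for f g
  proof
    fix x have "?c f (\<sigma> x) = ?c g (\<sigma> x)" using that by simp
    then show "f x = g x" using bij by (simp add: bij_is_inj inj_eq)
  qed
  have "finite (plane_permutations n)"
    by (rule finite_subset[of _ "{p. p permutes {1..n}} \<times> {p. p permutes {1..n}}"])
      (auto simp: plane_permutations_def intro!: finite_permutations)
  moreover have "inj_on (map_prod ?c ?c) A" for A
    by (rule inj_onI) (auto dest: inj_c)
  moreover have "map_prod ?c ?c P \<in> plane_permutations n \<and> diagonal (map_prod ?c ?c P) = ?c (diagonal P)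
      \<and> card (cycles_of n (snd (map_prod ?c ?c P))) = card (cycles_of n (snd P))"
    if "P \<in> plane_permutations n" for P
  proof -
    obtain s p where P: "P = (s, p)" by (cases P)
    with that have s: "s permutes {1..n}" "cyclic_on s {1..n}" and p: "p permutes {1..n}"
      by (auto simp: plane_permutations_def)
    from s(2) obtain x where x: "x \<in> {1..n}" "{1..n} = orbit s x" unfolding cyclic_on_def by blast
    have "orbit (?c s) (\<sigma> x) = {1..n}"
      using x(2) permutes_image[OF \<sigma>] orbit_conj_bij[OF bij] by metis
    then have cyc: "cyclic_on (?c s) {1..n}"
      unfolding cyclic_on_def using x(1) permutes_in_image[OF \<sigma>] by metis
    have "?c p \<circ> (\<sigma> \<circ> inv p \<circ> inv \<sigma>) = id" "(\<sigma> \<circ> inv p \<circ> inv \<sigma>) \<circ> ?c p = id"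
      using permutes_inv_o[OF \<sigma>] permutes_inv_o[OF p] by (simp_all add: fun_eq_iff)
    then have "inv (?c p) = \<sigma> \<circ> inv p \<circ> inv \<sigma>" by (rule inv_unique_comp)
    then have "diagonal (?c s, ?c p) = ?c (diagonal (s, p))"
      using permutes_inv_o[OF \<sigma>] by (simp add: diagonal_def fun_eq_iff)
    then show ?thesis
      using P cyc perm[OF s(1)] perm[OF p] card_cycles_of_conj[OF \<sigma>]
      by (simp add: plane_permutations_def)
  qed
  ultimately show ?thesis
    unfolding diagonal_count_def
    by (intro card_inj_on_le[of "map_prod ?c ?c"]) auto
qed

lemma exists_orbit_bij:
  assumes D: "permutation D" and E: "permutation E"
    and c: "card (orbit D x) = card (orbit E y)"
  shows "\<exists>g. bij_betw g (orbit D x) (orbit E y) \<and> (\<forall>z\<in>orbit D x. g (D z) = E (g z))"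
proof -
  have key: "(F ^^ i) w = (F ^^ j) w \<longleftrightarrow> i mod card (orbit F w) = j mod card (orbit F w)"
    if F: "permutation F" for F :: "'c \<Rightarrow> 'c" and w i j
  proof -
    define d where "d = least_power F w"
    have d: "(F ^^ d) w = w" "d > 0" using least_power_of_permutation[OF F] by (auto simp: d_def)
    have inj: "i = j" if "i \<le> j" "j < d" "(F ^^ i) w = (F ^^ j) w" for i j
    proof -
      have "(F ^^ i) ((F ^^ (j - i)) w) = (F ^^ i) w"
        using that by (simp flip: funpow_add comp_apply[of "F ^^ _" "F ^^ _"])
      moreover have "inj (F ^^ i)" using F by (simp add: bij_is_inj permutation_bijective bij_fn)
      ultimately have "(F ^^ (j - i)) w = w" by (simp add: inj_eq)
      then have "d dvd j - i" unfolding d_def by (rule least_power_minimal)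
      then show ?thesis using that by (auto dest: dvd_imp_le)
    qed
    then have inj': "i = j" if "i < d" "j < d" "(F ^^ i) w = (F ^^ j) w" for i j
      using that by (metis nat_le_linear)
    have "orbit F w = (\<lambda>i. (F ^^ i) w) ` {..<d}"
      using orbit_altdef_bounded[OF d] by auto
    then have "card (orbit F w) = d"
      using inj' by (simp add: card_image inj_on_def)
    then show ?thesis
      using inj'[of "i mod d" "j mod d"] d by (metis funpow_mod_eq mod_less_divisor)
  qed
  define g where "g z = (E ^^ (SOME i. (D ^^ i) x = z)) y" for z
  have g: "g ((D ^^ i) x) = (E ^^ i) y" for i
  proof -
    have "(D ^^ (SOME j. (D ^^ j) x = (D ^^ i) x)) x = (D ^^ i) x"
      by (rule someI[of _ i]) simp
    then show ?thesis unfolding g_def using key[OF D] key[OF E] c by metis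
  qed
  have oD: "orbit D x = range (\<lambda>i. (D ^^ i) x)" and oE: "orbit E y = range (\<lambda>i. (E ^^ i) y)"
    using orbit_altdef_permutation[OF D] orbit_altdef_permutation[OF E] by auto
  have "inj_on g (orbit D x)"
  proof (rule inj_onI)
    fix u v assume "u \<in> orbit D x" "v \<in> orbit D x" and eq: "g u = g v"
    then obtain i j where ij: "u = (D ^^ i) x" "v = (D ^^ j) x" unfolding oD by blast
    with eq g have "(E ^^ i) y = (E ^^ j) y" by simp
    then show "u = v" unfolding ij key[OF D] key[OF E] c .
  qed
  moreover have "g ` orbit D x = orbit E y" unfolding oD oE by (simp add: image_image g)
  moreover have "g (D z) = E (g z)" if z: "z \<in> orbit D x" for z
  proof -
    obtain i where "z = (D ^^ i) x" using z unfolding oD by blast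
    then show ?thesis using g[of i] g[of "Suc i"] by simp
  qed
  ultimately show ?thesis by (auto simp: bij_betw_def)
qed

lemma exists_conjugator:
  assumes D: "D \<in> perms_of_type n l" and E: "E \<in> perms_of_type n l"
  shows "\<exists>\<sigma>. \<sigma> permutes {1..n} \<and> E = \<sigma> \<circ> D \<circ> inv \<sigma>"
proof -
  have Dp: "D permutes {1..n}" and Ep: "E permutes {1..n}"
    and t: "cycle_type n D = cycle_type n E" using D E by (auto simp: perms_of_type_def)
  have Dq: "permutation D" and Eq: "permutation E"
    using Dp Ep by (auto simp: permutation_permutes)
  let ?A = "cycles_of n D" and ?B = "cycles_of n E"
  have fin: "finite ?A" "finite ?B" by (simp_all add: cycles_of_def)
  have "size (cycle_type n D) = size (cycle_type n E)" using t by simp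
  then have "card ?A = card ?B" by (simp add: cycle_type_def)
  then obtain h where h: "bij_betw h ?A ?B" using fin finite_same_card_bij by blast
  have "image_mset card (mset_set ?A) = image_mset card (image_mset h (mset_set ?A))"
    using t h by (simp add: cycle_type_def bij_betw_def image_mset_mset_set)
  then have "image_mset card (mset_set ?A) = image_mset (\<lambda>a. card (h a)) (mset_set ?A)"
    by (simp add: image_mset.compositionality comp_def)
  then obtain r where r: "r permutes ?A" "\<forall>a\<in>?A. card a = card (h (r a))"
    using image_mset_eq_implies_permutes[OF fin(1)] by blast
  define F where "F = h \<circ> r"
  have F: "bij_betw F ?A ?B" unfolding F_def
    using bij_betw_trans[OF permutes_imp_bij[OF r(1)] h] .
  have "\<exists>g. bij_betw g a (F a) \<and> (\<forall>z\<in>a. g (D z) = E (g z))" if a: "a \<in> ?A" for a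
  proof -
    obtain x where x: "a = orbit D x" using a by (auto simp: cycles_of_def)
    have "F a \<in> ?B" using F a by (auto simp: bij_betw_def)
    then obtain y where y: "F a = orbit E y" by (auto simp: cycles_of_def)
    have "card (orbit D x) = card (orbit E y)"
      using r(2) a x y by (metis F_def comp_apply)
    then show ?thesis using exists_orbit_bij[OF Dq Eq] x y by auto
  qed
  then obtain g where g: "\<And>a. a \<in> ?A \<Longrightarrow> bij_betw (g a) a (F a)"
      "\<And>a z. a \<in> ?A \<Longrightarrow> z \<in> a \<Longrightarrow> g a (D z) = E (g a z)" by metis
  define \<sigma> where "\<sigma> z = (if z \<in> {1..n} then g (orbit D z) z else z)" for z
  have self: "z \<in> orbit D z" "z \<in> orbit E z" for z
    using permutation_self_in_orbit[OF Dq] permutation_self_in_orbit[OF Eq] by auto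
  have inA: "orbit D z \<in> ?A" if "z \<in> {1..n}" for z using that by (auto simp: cycles_of_def)
  have subA: "a \<subseteq> {1..n}" "\<And>z. z \<in> a \<Longrightarrow> orbit D z = a" if a: "a \<in> ?A" for a
  proof -
    obtain x where x: "x \<in> {1..n}" "a = orbit D x" using a by (auto simp: cycles_of_def)
    show "a \<subseteq> {1..n}" using permutes_orbit_subset[OF Dp x(1)] x by simp
    show "orbit D z = a" if "z \<in> a" for z
      using that x orbit_cyclic_eq3[OF cyclic_on_orbit'[OF Dq]] by blast
  qed
  have subB: "b \<subseteq> {1..n}" "\<And>z. z \<in> b \<Longrightarrow> orbit E z = b" if b: "b \<in> ?B" for b
  proof -
    obtain x where x: "x \<in> {1..n}" "b = orbit E x" using b by (auto simp: cycles_of_def)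
    show "b \<subseteq> {1..n}" using permutes_orbit_subset[OF Ep x(1)] x by simp
    show "orbit E z = b" if "z \<in> b" for z
      using that x orbit_cyclic_eq3[OF cyclic_on_orbit'[OF Eq]] by blast
  qed
  have FB: "F a \<in> ?B" if "a \<in> ?A" for a using F that by (auto simp: bij_betw_def)
  have in_F: "\<sigma> z \<in> F (orbit D z)" if "z \<in> {1..n}" for z
    using g(1)[OF inA[OF that]] self(1) that by (auto simp: \<sigma>_def bij_betw_def)
  have \<sigma>_in: "\<sigma> z \<in> {1..n}" if "z \<in> {1..n}" for z
    using in_F[OF that] subB(1)[OF FB[OF inA[OF that]]] by blast
  have "inj_on \<sigma> {1..n}"
  proof (rule inj_onI)
    fix z w assume zw: "z \<in> {1..n}" "w \<in> {1..n}" "\<sigma> z = \<sigma> w"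
    have "F (orbit D z) = F (orbit D w)"
      using subB(2)[OF FB[OF inA[OF zw(1)]] in_F[OF zw(1)]]
        subB(2)[OF FB[OF inA[OF zw(2)]] in_F[OF zw(2)]] zw(3) by simp
    then have o: "orbit D z = orbit D w"
      using F inA zw by (auto simp: bij_betw_def inj_on_def)
    then show "z = w"
      using g(1)[OF inA[OF zw(1)]] self(1)[of z] self(1)[of w] zw
      by (auto simp: \<sigma>_def bij_betw_def inj_on_def)
  qed
  moreover have "\<sigma> ` {1..n} \<subseteq> {1..n}" using \<sigma>_in by blast
  ultimately have "bij_betw \<sigma> {1..n} {1..n}"
    by (simp add: bij_betw_def endo_inj_surj)
  then have \<sigma>: "\<sigma> permutes {1..n}"
    by (rule bij_imp_permutes) (auto simp: \<sigma>_def)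
  have comm: "\<sigma> (D z) = E (\<sigma> z)" for z
  proof (cases "z \<in> {1..n}")
    case True
    then have "D z \<in> {1..n}" using permutes_in_image[OF Dp] by blast
    moreover have "orbit D (D z) = orbit D z" using permutation_orbit_step[OF Dq] .
    ultimately show ?thesis using True g(2)[OF inA[OF True] self(1)] by (simp add: \<sigma>_def)
  next
    case False
    then have "D z = z" "E z = z" "\<sigma> z = z"
      using permutes_not_in[OF Dp] permutes_not_in[OF Ep] permutes_not_in[OF \<sigma>] by auto
    then show ?thesis by simp
  qed
  have "E = \<sigma> \<circ> D \<circ> inv \<sigma>"
    using comm permutes_inverses(1)[OF \<sigma>] by (simp add: fun_eq_iff)
  with \<sigma> show ?thesis by blast
qed

lemma plane_count_eq:
  assumes D: "D \<in> perms_of_type n l"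
  shows "plane_count n k l = diagonal_count n k D"
proof -
  define E where "E = (SOME D. D \<in> perms_of_type n l)"
  have E: "E \<in> perms_of_type n l" unfolding E_def by (rule someI[of "\<lambda>D. D \<in> perms_of_type n l", OF D])
  have "diagonal_count n k A \<le> diagonal_count n k B"
    if "A \<in> perms_of_type n l" "B \<in> perms_of_type n l" for A B
    using exists_conjugator[OF that] diagonal_count_conj_le by blast
  then show ?thesis using D E by (metis E_def plane_count_def order_antisym)
qed

lemma perms_of_type_nonempty:
  assumes "l \<in> number_partitions n" shows "perms_of_type n l \<noteq> {}"
  using assms
proof (induction l arbitrary: n)
  case empty
  then have "id \<in> perms_of_type n {#}"
    by (simp add: number_partitions_def perms_of_type_def cycle_type_def cycles_of_def)
  then show ?case by blast
next
  case (add a l)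
  define m where "m = sum_mset l"
  have a: "a > 0" and n: "n = m + a" and l: "l \<in> number_partitions m"
    using add.prems by (auto simp: number_partitions_def m_def)
  obtain D where D: "D permutes {1..m}" "cycle_type m D = l"
    using add.IH[OF l] by (auto simp: perms_of_type_def)
  define E where "E x = (if x \<le> m then D x else if x < n then x + 1 else if x = n then m + 1 else x)" for x
  have D_le: "D x \<le> m \<longleftrightarrow> x \<le> m" for x
  proof (cases "x \<in> {1..m}")
    case True
    then have "D x \<in> {1..m}" using permutes_in_image[OF D(1)] by blast
    with True show ?thesis by simp
  qed (use permutes_not_in[OF D(1)] in simp)
  have D_pos: "D x \<ge> 1 \<longleftrightarrow> x \<ge> 1" for x
  proof (cases "x \<in> {1..m}")
    case True
    then have "D x \<in> {1..m}" using permutes_in_image[OF D(1)] by blast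
    with True show ?thesis by simp
  qed (use permutes_not_in[OF D(1)] in simp)
  have "inj_on E {1..n}"
  proof (rule inj_onI)
    fix x y assume "x \<in> {1..n}" "y \<in> {1..n}" "E x = E y"
    then show "x = y"
      using D_le[of x] D_le[of y] permutes_inj[OF D(1)] a n
      by (auto simp: E_def inj_eq split: if_splits)
  qed
  moreover have "E ` {1..n} \<subseteq> {1..n}"
  proof (rule image_subsetI)
    fix x assume "x \<in> {1..n}"
    then show "E x \<in> {1..n}" using D_le[of x] D_pos[of x] a n by (auto simp: E_def)
  qed
  ultimately have "bij_betw E {1..n} {1..n}" by (simp add: bij_betw_def endo_inj_surj)
  then have E: "E permutes {1..n}"
    by (rule bij_imp_permutes) (use a n permutes_not_in[OF D(1)] in \<open>auto simp: E_def\<close>)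
  have "(E ^^ i) (m + 1) = m + 1 + i" if "i < a" for i
    using that by (induction i) (auto simp: E_def n)
  note iter = this
  have "(E ^^ a) (m + 1) = E ((E ^^ (a - 1)) (m + 1))"
    using a by (metis Suc_diff_1 comp_apply funpow.simps(2))
  also have "\<dots> = m + 1" using a iter[of "a - 1"] by (simp add: E_def n)
  finally have "orbit E (m + 1) = {(E ^^ i) (m + 1) | i. i < a}"
    using a by (intro orbit_altdef_bounded)
  also have "\<dots> = (\<lambda>i. m + 1 + i) ` {..<a}" using iter by force
  also have "\<dots> = {m + 1..n}"
  proof
    show "{m + 1..n} \<subseteq> (\<lambda>i. m + 1 + i) ` {..<a}"
    proof
      fix x assume "x \<in> {m + 1..n}"
      then have "x = m + 1 + (x - (m + 1))" "x - (m + 1) \<in> {..<a}" using n by auto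
      then show "x \<in> (\<lambda>i. m + 1 + i) ` {..<a}" by blast
    qed
  qed (auto simp: n)
  finally have o: "orbit E (m + 1) = {m + 1..n}" .
  have "cyclic_on E {m + 1..n}" unfolding cyclic_on_def using o a n by (intro bexI[of _ "m + 1"]) auto
  then have new: "orbit E x = {m + 1..n}" if "x \<in> {m + 1..n}" for x
    using that by (rule orbit_cyclic_eq3)
  have old: "orbit E x = orbit D x" if "x \<in> {1..m}" for x
  proof -
    have "(D ^^ i) x \<le> m" for i using that by (induction i) (auto simp: D_le)
    then have "(E ^^ i) x = (D ^^ i) x" for i by (induction i) (auto simp: E_def)
    then show ?thesis by (simp add: orbit_altdef)
  qed
  have "{1..n} = {1..m} \<union> {m + 1..n}" using n by auto
  then have "cycles_of n E = orbit E ` {1..m} \<union> orbit E ` {m + 1..n}"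
    unfolding cycles_of_def by (simp only: image_Un)
  also have "orbit E ` {1..m} = cycles_of m D" using old by (simp add: cycles_of_def)
  also have "orbit E ` {m + 1..n} = (\<lambda>_. {m + 1..n}) ` {m + 1..n}" using new by (rule image_cong[OF refl])
  also have "\<dots> = {{m + 1..n}}"
    using a n by (simp only: image_constant_conv) simp
  finally have "cycles_of n E = insert {m + 1..n} (cycles_of m D)" by simp
  moreover have "{m + 1..n} \<notin> cycles_of m D"
  proof
    assume "{m + 1..n} \<in> cycles_of m D"
    then obtain x where "x \<in> {1..m}" "{m + 1..n} = orbit D x" by (auto simp only: cycles_of_def)
    then have "{m + 1..n} \<subseteq> {1..m}" using permutes_orbit_subset[OF D(1)] by blast
    then show False using a n by auto
  qed
  ultimately have "cycle_type n E = add_mset a l"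
    using D(2) n by (simp add: cycle_type_def cycles_of_def)
  with E show ?case by (auto simp: perms_of_type_def)
qed

text \<open>By the following two facts, the sums over all \<open>i \<ge> 1\<close> (written with \<open>infsum\<close>)
  have only finitely many non-zero terms.\<close>

lemma plane_count_eq_0:
  assumes "n < k" shows "plane_count n k l = 0"
proof -
  have "card (cycles_of n p) \<le> n" for p
    using card_image_le[of "{1..n}" "orbit p"] by (simp add: cycles_of_def)
  then have "{P \<in> plane_permutations n. diagonal P = D \<and> card (cycles_of n (snd P)) = k} = {}" for D
    using assms by (auto simp: not_le[symmetric])
  then show ?thesis by (simp only: plane_count_def diagonal_count_def card.empty)
qed

lemma splits_part_le:
  assumes "splits_part j m l" "l \<in> number_partitions n"
  shows "j \<le> n"
proof -
  obtain a v where a: "a \<in># l" "size v = j" "0 \<notin># v" "sum_mset v = a"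
    using assms(1) by (auto simp: splits_part_def)
  have "size v \<le> sum_mset v" using a(3) by (induction v) auto
  also have "sum_mset v \<le> sum_mset l" using a(1,4) by (metis insert_DiffM le_add1 sum_mset.add_mset)
  finally show ?thesis using a assms(2) by (simp add: number_partitions_def)
qed

end

theory Submission
  imports Defs
begin

text \<open>
  Up to conjugation the long cycle is \<open>rot n\<close>, so one counts permutations \<open>f\<close> of \<open>{1..n}\<close> with
  \<open>k\<close> cycles whose diagonal \<open>D = rot n \<circ> inv f\<close> has type \<open>l\<close>. A point \<open>z\<close> with \<open>z \<le> inv f z\<close> is an
  anti-exceedance of \<open>f\<close>; the minimum of each cycle is a trivial one. Together \<open>f\<close> and \<open>D\<close> have
  exactly \<open>n + 1\<close> anti-exceedances, hence \<open>n + 1 - k - size l\<close> non-trivial ones.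

  A non-trivial anti-exceedance is Chapuy's trisection: cutting its cycle there, by swapping two
  adjacent blocks of the long cycle, yields three cycles, the third of which carries a marked
  anti-exceedance that is either the minimum of its cycle or again non-trivial. Iterating, the
  permutations with a marked non-trivial anti-exceedance correspond to the permutations with
  \<open>2 * i + 1\<close> selected cycles, \<open>i \<ge> 1\<close>, the original type being recovered by merging the selected
  cycles. For the anti-exceedances of \<open>f\<close> this gives the binomial sum; exchanging the roles of \<open>f\<close>
  and \<open>D\<close>, it gives the sum over the partitions that split a part of \<open>l\<close>.
\<close>

section \<open>Swapping two adjacent blocks of the long cycle\<close>

text \<open>The long cycle \<open>(1 2 ... n)\<close>. For \<open>n = 0\<close> it would send
  \<open>0\<close> to \<open>1\<close>, which is why \<open>n \<ge> 1\<close> recurs below.\<close>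

definition rot :: "nat \<Rightarrow> nat \<Rightarrow> nat" where
  "rot n x = (if 1 \<le> x \<and> x < n then Suc x else if x = n then 1 else x)"

text \<open>The new position of the letter \<open>x\<close> of the word \<open>1 ... n\<close> once
  the blocks \<open>a+1 ... b\<close> and \<open>b+1 ... c\<close> have changed places.\<close>

definition block_swap :: "nat \<Rightarrow> nat \<Rightarrow> nat \<Rightarrow> nat \<Rightarrow> nat" where
  "block_swap a b c x =
     (if x \<le> a then x else if x \<le> b then x + (c - b) else if x \<le> c then x - (b - a) else x)"

definition three_cycle :: "nat \<Rightarrow> nat \<Rightarrow> nat \<Rightarrow> nat \<Rightarrow> nat" where
  "three_cycle a b c x = (if x = a then b else if x = b then c else if x = c then a else x)"

lemma rot_permutes: "rot n permutes {1..n}" if "n \<ge> 1"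
proof -
  have "inj_on (rot n) {1..n}" by (auto simp: inj_on_def rot_def split: if_splits)
  moreover have "rot n ` {1..n} \<subseteq> {1..n}" by (auto simp: rot_def)
  ultimately have "bij_betw (rot n) {1..n} {1..n}" by (simp add: bij_betw_def endo_inj_surj)
  then show ?thesis by (rule bij_imp_permutes) (use that in \<open>auto simp: rot_def\<close>)
qed

text \<open>After the exchange the first block has length \<open>c - b\<close>, so the same exchange
  with inner cut \<open>a + c - b\<close> undoes it.\<close>

lemma block_swap_inverse:
  assumes "a < b" "b < c"
  shows "block_swap a (a + c - b) c (block_swap a b c x) = x"
    "block_swap a b c (block_swap a (a + c - b) c x) = x"
  using assms by (auto simp: block_swap_def)

lemma bij_block_swap:
  assumes "a < b" "b < c"
  shows "bij (block_swap a b c)"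
  using block_swap_inverse[OF assms] by (intro o_bij[of "block_swap a (a + c - b) c"]) auto

lemma block_swap_permutes:
  assumes "a < b" "b < c" "c \<le> n"
  shows "block_swap a b c permutes {1..n}"
proof -
  have "\<And>x. x \<notin> {1..n} \<Longrightarrow> block_swap a b c x = x" using assms by (auto simp: block_swap_def)
  with bij_block_swap[OF assms(1,2)] show ?thesis
    unfolding permutes_def bij_iff by blast
qed

lemma three_cycle_permutes_support:
  assumes "a < b" "b < c"
  shows "three_cycle a b c permutes {a, b, c}"
proof -
  \<comment> \<open>\<open>three_cycle b a c\<close> runs through the same points in the opposite
    direction.\<close>
  have "three_cycle a b c (three_cycle b a c x) = x" "three_cycle b a c (three_cycle a b c x) = x" for x
    using assms by (auto simp: three_cycle_def)
  then have "bij (three_cycle a b c)" by (intro o_bij[of "three_cycle b a c"]) auto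
  moreover have "\<And>x. x \<notin> {a, b, c} \<Longrightarrow> three_cycle a b c x = x" by (auto simp: three_cycle_def)
  ultimately show ?thesis
    unfolding permutes_def bij_iff by blast
qed

lemma three_cycle_permutes:
  assumes "a < b" "b < c" "1 \<le> a" "c \<le> n"
  shows "three_cycle a b c permutes {1..n}"
  using assms by (intro permutes_subset[OF three_cycle_permutes_support]) auto

text \<open>In the exchanged word \<open>a\<close> is followed by \<open>b+1\<close>,
  \<open>b\<close> by the old successor of \<open>c\<close>, and \<open>c\<close> by
  \<open>a+1\<close>; elsewhere successors are unchanged. So the new long cycle is
  \<open>rot n \<circ> three_cycle a b c\<close>, and renaming letters by their positions turns it
  into \<open>rot n\<close>.\<close>

lemma block_swap_rot:
  assumes "a < b" "b < c" "1 \<le> a" "c \<le> n"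
  shows "block_swap a b c (rot n (three_cycle a b c x)) = rot n (block_swap a b c x)"
proof -
  consider "x < a" | "x = a" | "a < x" "x < b" | "x = b" | "b < x" "x < c" | "x = c" | "c < x"
    by linarith
  then show ?thesis
    by cases (use assms in \<open>(simp_all add: block_swap_def rot_def three_cycle_def, arith+)\<close>)
qed

text \<open>The renaming sends \<open>a, b, c\<close> to \<open>a, c, a + c - b\<close>, so it
  conjugates the three-cycle into the inverse of the three-cycle at the new cut points.\<close>

lemma three_cycle_block_swap:
  assumes "a < b" "b < c"
  shows "three_cycle a (a + c - b) c (block_swap a b c (three_cycle a b c x)) = block_swap a b c x"
proof -
  consider "x < a" | "x = a" | "a < x" "x < b" | "x = b" | "b < x" "x < c" | "x = c" | "c < x"
    by linarith
  then show ?thesis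
    by cases (use assms in \<open>(simp_all add: block_swap_def three_cycle_def, arith+)\<close>)
qed

text \<open>For \<open>a < b < c\<close>, cutting the word \<open>1 \<dots> n\<close> after \<open>a\<close>, \<open>b\<close> and \<open>c\<close> and exchanging the two
  middle blocks turns the long cycle \<open>s\<close> into \<open>s \<circ> three_cycle a b c\<close>; multiplying \<open>f\<close> by the same
  three-cycle keeps the diagonal. Conjugation by \<open>block_swap\<close> renames the points so that the long
  cycle is \<open>rot n\<close> again. The cut points become \<open>a < a + c - b < c\<close>.\<close>

definition reglue :: "(nat \<Rightarrow> nat) \<Rightarrow> nat \<Rightarrow> nat \<Rightarrow> nat \<Rightarrow> nat \<Rightarrow> nat" where
  "reglue f a b c = block_swap a b c \<circ> (f \<circ> three_cycle a b c) \<circ> inv (block_swap a b c)"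

lemma inv_block_swap:
  assumes "a < b" "b < c"
  shows "inv (block_swap a b c) = block_swap a (a + c - b) c"
  using block_swap_inverse[OF assms] by (intro inv_unique_comp) auto

lemma reglue_permutes:
  assumes "a < b" "b < c" "1 \<le> a" "c \<le> n" "f permutes {1..n}"
  shows "reglue f a b c permutes {1..n}"
proof -
  have r: "block_swap a b c permutes {1..n}" and g: "three_cycle a b c permutes {1..n}"
    using block_swap_permutes three_cycle_permutes assms by blast+
  show ?thesis unfolding reglue_def
    by (rule permutes_compose[OF permutes_inv[OF r] permutes_compose[OF permutes_compose[OF g assms(5)] r]])
qed

text \<open>The two conjugations cancel and, by \<open>three_cycle_block_swap\<close>, so do the two
  three-cycles.\<close>

lemma reglue_involution:
  assumes "a < b" "b < c"
  shows "reglue (reglue f a b c) a (a + c - b) c = f"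
proof
  fix x
  define b' where "b' = a + c - b"
  have b': "a < b'" "b' < c" "a + c - b' = b" using assms by (auto simp: b'_def)
  note inverse = block_swap_inverse[OF assms, folded b'_def]
  obtain y where y: "three_cycle a b c y = x"
  proof
    show "three_cycle a b c (three_cycle b a c x) = x" using assms by (auto simp: three_cycle_def)
  qed
  have "three_cycle a b' c (block_swap a b c x) = block_swap a b c y"
    using three_cycle_block_swap[OF assms, of y] y by (simp add: b'_def)
  then have "block_swap a b' c (block_swap a b c (f (three_cycle a b c (block_swap a b' c
      (three_cycle a b' c (block_swap a b c x)))))) = f x"
    by (simp only: inverse y)
  moreover have "inv (block_swap a b c) = block_swap a b' c" "inv (block_swap a b' c) = block_swap a b c"
    using inv_block_swap[OF assms] inv_block_swap[OF b'(1,2)] b'(3) by (simp_all only: b'_def)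
  ultimately show "reglue (reglue f a b c) a (a + c - b) c x = f x"
    by (simp only: reglue_def comp_apply b'_def[symmetric])
qed

text \<open>The diagonal \<open>s \<circ> inv \<pi>\<close> of the plane permutation \<open>(s, \<pi>) = (rot n, f)\<close>.\<close>

definition codiag :: "nat \<Rightarrow> (nat \<Rightarrow> nat) \<Rightarrow> nat \<Rightarrow> nat" where
  "codiag n f = rot n \<circ> inv f"

lemma codiag_permutes:
  assumes "n \<ge> 1" "f permutes {1..n}"
  shows "codiag n f permutes {1..n}"
  unfolding codiag_def by (rule permutes_compose[OF permutes_inv[OF assms(2)] rot_permutes[OF assms(1)]])

text \<open>The long cycle and \<open>f\<close> are both multiplied on the right by the same
  three-cycle, which cancels in the diagonal; only the renaming remains.\<close>

lemma codiag_reglue: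
  assumes "a < b" "b < c" "1 \<le> a" "c \<le> n" "f permutes {1..n}"
  shows "codiag n (reglue f a b c) = block_swap a b c \<circ> codiag n f \<circ> inv (block_swap a b c)"
proof -
  let ?r = "block_swap a b c" and ?g = "three_cycle a b c"
  have r: "?r permutes {1..n}" and g: "?g permutes {1..n}"
    using block_swap_permutes three_cycle_permutes assms by blast+
  have "inv (reglue f a b c) = ?r \<circ> inv ?g \<circ> inv f \<circ> inv ?r"
    unfolding reglue_def
    using permutes_inv_o[OF r] permutes_inv_o[OF g] permutes_inv_o[OF assms(5)]
    by (intro inv_unique_comp) (simp_all add: fun_eq_iff)
  moreover have "rot n (?r (inv ?g y)) = ?r (rot n y)" for y
    using block_swap_rot[OF assms(1-4), of "inv ?g y"] permutes_inverses(1)[OF g] by simp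
  ultimately show ?thesis by (simp add: codiag_def fun_eq_iff)
qed

lemma cycle_type_conj:
  assumes "\<sigma> permutes {1..n}"
  shows "cycle_type n (\<sigma> \<circ> f \<circ> inv \<sigma>) = cycle_type n f"
proof -
  have inj: "inj \<sigma>" using assms by (rule permutes_inj)
  then have "inj_on ((`) \<sigma>) (cycles_of n f)" by (intro inj_on_image) (auto intro: inj_on_subset)
  then have "cycle_type n (\<sigma> \<circ> f \<circ> inv \<sigma>)
      = image_mset card (image_mset ((`) \<sigma>) (mset_set (cycles_of n f)))"
    unfolding cycle_type_def cycles_of_conj[OF assms] by (simp add: image_mset_mset_set)
  also have "\<dots> = cycle_type n f"
    using inj by (simp add: cycle_type_def image_mset.compositionality comp_def
        card_image inj_on_subset)
  finally show ?thesis .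
qed

lemma cycle_type_codiag_reglue:
  assumes "a < b" "b < c" "1 \<le> a" "c \<le> n" "f permutes {1..n}"
  shows "cycle_type n (codiag n (reglue f a b c)) = cycle_type n (codiag n f)"
  unfolding codiag_reglue[OF assms] by (rule cycle_type_conj[OF block_swap_permutes[OF assms(1,2,4)]])

section \<open>Cycles and types under the move\<close>

lemma permutes_permutation: "f permutes {1..n::nat} \<Longrightarrow> permutation f"
  by (auto simp: permutation_permutes)

lemma in_orbit_iff_funpow:
  assumes "f permutes {1..n::nat}"
  shows "y \<in> orbit f x \<longleftrightarrow> (\<exists>i. y = (f ^^ i) x)"
  using orbit_altdef_permutation[OF permutes_permutation[OF assms]] by auto

lemma orbit_self: "f permutes {1..n::nat} \<Longrightarrow> x \<in> orbit f x"
  by (rule permutation_self_in_orbit[OF permutes_permutation])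

lemma orbit_eq_orbit:
  assumes "f permutes {1..n::nat}" "y \<in> orbit f x"
  shows "orbit f y = orbit f x"
  using orbit_cyclic_eq3[OF cyclic_on_orbit'[OF permutes_permutation[OF assms(1)]] assms(2)] .

lemma cycles_of_eq_orbit:
  assumes "f permutes {1..n}" "X \<in> cycles_of n f" "x \<in> X"
  shows "X = orbit f x"
  using assms orbit_eq_orbit by (auto simp: cycles_of_def)

lemma cycles_of_subset:
  assumes "f permutes {1..n}" "X \<in> cycles_of n f"
  shows "X \<subseteq> {1..n}"
  using assms permutes_orbit_subset by (fastforce simp: cycles_of_def)

lemma cycles_of_finite:
  assumes "f permutes {1..n}" "X \<in> cycles_of n f"
  shows "finite X" "X \<noteq> {}"
  using cycles_of_subset[OF assms] finite_subset assms orbit_nonempty[of f]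
  by (auto simp: cycles_of_def)

lemma cycles_of_disjoint:
  assumes "f permutes {1..n}" "X \<in> cycles_of n f" "Y \<in> cycles_of n f" "X \<noteq> Y"
  shows "X \<inter> Y = {}"
  using cycles_of_eq_orbit[OF assms(1)] assms by blast

lemma finite_cycles_of [simp]: "finite (cycles_of n f)"
  by (simp add: cycles_of_def)

section \<open>Cycles touched and untouched by a factor with small support\<close>

text \<open>The union on the right is closed under \<open>f \<circ> g\<close>: \<open>g\<close> maps
  \<open>T\<close> into itself and fixes everything else, and \<open>f\<close> does not leave an
  orbit.\<close>

lemma orbits_comp_subset:
  assumes f: "f permutes {1..n::nat}" and g: "g permutes T"
  shows "(\<Union>t\<in>T. orbit (f \<circ> g) t) \<subseteq> (\<Union>t\<in>T. orbit f t)"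
proof -
  let ?U = "\<Union>t\<in>T. orbit f t"
  have step: "(f \<circ> g) y \<in> ?U" if "y \<in> ?U" for y
  proof (cases "y \<in> T")
    case True
    then have "g y \<in> T" using permutes_in_image[OF g] by blast
    then show ?thesis by (auto intro: orbit.base)
  next
    case False
    then have "g y = y" using g by (simp add: permutes_not_in)
    with that show ?thesis by (auto intro: orbit.step)
  qed
  have "x \<in> ?U" if "x \<in> orbit (f \<circ> g) t" "t \<in> T" for x t
    using that(1)
  proof induction
    case base
    have "t \<in> ?U" using that(2) orbit_self[OF f] by blast
    then show ?case by (rule step)
  next
    case (step y)
    then show ?case using \<open>\<And>y. y \<in> ?U \<Longrightarrow> (f \<circ> g) y \<in> ?U\<close> by blast
  qed
  then show ?thesis by blast
qed

text \<open>The reverse inclusion is \<open>orbits_comp_subset\<close> for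
  \<open>f \<circ> g\<close> and \<open>inv g\<close>, whose product is \<open>f\<close>.\<close>

lemma orbits_comp:
  assumes f: "f permutes {1..n::nat}" and g: "g permutes T" and T: "T \<subseteq> {1..n}"
  shows "(\<Union>t\<in>T. orbit (f \<circ> g) t) = (\<Union>t\<in>T. orbit f t)"
proof
  have fg: "f \<circ> g permutes {1..n}" using permutes_compose[OF permutes_subset[OF g T] f] .
  have "(f \<circ> g) \<circ> inv g = f" using permutes_inv_o[OF g] by (simp add: comp_assoc)
  then show "(\<Union>t\<in>T. orbit f t) \<subseteq> (\<Union>t\<in>T. orbit (f \<circ> g) t)"
    using orbits_comp_subset[OF fg permutes_inv[OF g]] by simp
qed (rule orbits_comp_subset[OF f g])

text \<open>On a cycle that avoids \<open>T\<close> the maps \<open>f\<close> and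
  \<open>f \<circ> g\<close> agree.\<close>

lemma cycles_disjoint_comp_subset:
  assumes f: "f permutes {1..n::nat}" and g: "g permutes T" and W: "T \<subseteq> W" and T: "T \<subseteq> {1..n}"
  shows "{X \<in> cycles_of n f. X \<inter> W = {}} \<subseteq> {X \<in> cycles_of n (f \<circ> g). X \<inter> W = {}}"
proof
  fix X assume "X \<in> {X \<in> cycles_of n f. X \<inter> W = {}}"
  then obtain x where x: "x \<in> {1..n}" "X = orbit f x" "X \<inter> W = {}" by (auto simp: cycles_of_def)
  have "orbit f x = orbit (f \<circ> g) x"
  proof (rule orbit_cong0)
    show "x \<in> X" using orbit_self[OF f] x by simp
    show "f \<in> X \<rightarrow> X" using x by (auto intro: orbit.step)
    fix y assume "y \<in> X"
    then have "y \<notin> T" using x W by blast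
    then show "f y = (f \<circ> g) y" using g by (simp add: permutes_not_in)
  qed
  then show "X \<in> {X \<in> cycles_of n (f \<circ> g). X \<inter> W = {}}"
    using x by (auto simp: cycles_of_def)
qed

lemma cycles_disjoint_comp:
  assumes f: "f permutes {1..n::nat}" and g: "g permutes T" and W: "T \<subseteq> W" and T: "T \<subseteq> {1..n}"
  shows "{X \<in> cycles_of n (f \<circ> g). X \<inter> W = {}} = {X \<in> cycles_of n f. X \<inter> W = {}}"
proof
  have fg: "f \<circ> g permutes {1..n}" using permutes_compose[OF permutes_subset[OF g T] f] .
  have "(f \<circ> g) \<circ> inv g = f" using permutes_inv_o[OF g] by (simp add: comp_assoc)
  then show "{X \<in> cycles_of n (f \<circ> g). X \<inter> W = {}} \<subseteq> {X \<in> cycles_of n f. X \<inter> W = {}}"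
    using cycles_disjoint_comp_subset[OF fg permutes_inv[OF g] W T] by simp
qed (rule cycles_disjoint_comp_subset[OF f g W T])

text \<open>\<open>W\<close> is meant to be a union of cycles of \<open>f\<close>. Since only \<open>W\<close> enters, the value does not
  see how many cycles make up \<open>W\<close>, so it is invariant under the move.\<close>

definition merged_type :: "nat \<Rightarrow> (nat \<Rightarrow> nat) \<Rightarrow> nat set \<Rightarrow> nat multiset" where
  "merged_type n f W =
     add_mset (card W) (image_mset card (mset_set {X \<in> cycles_of n f. X \<inter> W = {}}))"

lemma merged_type_comp:
  assumes "f permutes {1..n::nat}" "g permutes T" "T \<subseteq> W" "T \<subseteq> {1..n}"
  shows "merged_type n (f \<circ> g) W = merged_type n f W"
  unfolding merged_type_def cycles_disjoint_comp[OF assms] ..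

lemma inj_on_image_set: "inj f \<Longrightarrow> inj_on ((`) f) A"
  by (auto simp: inj_on_def inj_image_eq_iff)

lemma merged_type_conj:
  assumes \<sigma>: "\<sigma> permutes {1..n}"
  shows "merged_type n (\<sigma> \<circ> f \<circ> inv \<sigma>) (\<sigma> ` W) = merged_type n f W"
proof -
  have inj: "inj \<sigma>" using assms by (rule permutes_inj)
  let ?C = "{X \<in> cycles_of n f. X \<inter> W = {}}"
  have "\<sigma> ` X \<inter> \<sigma> ` W = {} \<longleftrightarrow> X \<inter> W = {}" for X
    using inj by (simp flip: image_Int)
  then have eq: "{X \<in> cycles_of n (\<sigma> \<circ> f \<circ> inv \<sigma>). X \<inter> \<sigma> ` W = {}} = (`) \<sigma> ` ?C"
    unfolding cycles_of_conj[OF \<sigma>] by auto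
  have "inj_on ((`) \<sigma>) ?C" using inj by (rule inj_on_image_set)
  then have "mset_set ((`) \<sigma> ` ?C) = image_mset ((`) \<sigma>) (mset_set ?C)"
    by (simp add: image_mset_mset_set)
  then show ?thesis
    unfolding merged_type_def eq
    by (simp add: image_mset.compositionality comp_def card_image[OF inj_on_subset[OF inj]])
qed

text \<open>Cut points \<open>a < b < c\<close> with a set \<open>A\<close> of \<open>m\<close>
  further cycles. Each cycle in \<open>A\<close> reaches below \<open>a\<close> and the cycles
  through the cut points do not, so the two groups are disjoint. \<open>P\<close> is a condition on
  two invariants of the move; leaving it open lets one bijection serve both sums, where
  \<open>P\<close> prescribes one of the two types and the size of the other.\<close>

definition config ::
  "nat \<Rightarrow> nat \<Rightarrow> (nat multiset \<Rightarrow> nat multiset \<Rightarrow> bool) \<Rightarrow> (nat \<Rightarrow> nat) \<Rightarrow> nat set set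
     \<Rightarrow> nat \<Rightarrow> nat \<Rightarrow> nat \<Rightarrow> bool" where
  "config n m P f A a b c \<longleftrightarrow>
     f permutes {1..n} \<and> 1 \<le> a \<and> a < b \<and> b < c \<and> c \<le> n \<and>
     A \<subseteq> cycles_of n f \<and> card A = m \<and> (\<forall>X\<in>A. \<exists>x\<in>X. x < a) \<and>
     (\<forall>x\<in>(\<Union>t\<in>{a, b, c}. orbit f t). a \<le> x) \<and>
     P (cycle_type n (codiag n f)) (merged_type n f (\<Union>A \<union> (\<Union>t\<in>{a, b, c}. orbit f t)))"

text \<open>The three-cycle disturbs only the cycles through the cut points and keeps their union,
  so the merged type survives. The renaming fixes every point below \<open>a\<close> and keeps all
  others at or above \<open>a\<close>.\<close>

lemma config_reglue:
  assumes "config n m P f A a b c"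
  shows "config n m P (reglue f a b c) ((`) (block_swap a b c) ` A) a (a + c - b) c"
proof -
  let ?r = "block_swap a b c" and ?g = "three_cycle a b c" and ?f = "reglue f a b c"
  let ?U = "\<Union>t\<in>{a, b, c}. orbit f t"
  have f: "f permutes {1..n}" and abc: "1 \<le> a" "a < b" "b < c" "c \<le> n"
    and A: "A \<subseteq> cycles_of n f" "card A = m" "\<And>X. X \<in> A \<Longrightarrow> \<exists>x\<in>X. x < a"
    and U: "\<And>x. x \<in> ?U \<Longrightarrow> a \<le> x"
    and P: "P (cycle_type n (codiag n f)) (merged_type n f (\<Union>A \<union> ?U))"
    using assms by (auto simp: config_def)
  have abcn: "{a, b, c} \<subseteq> {1..n}" using abc by auto
  have r: "?r permutes {1..n}" using abc by (intro block_swap_permutes)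
  have injr: "inj ?r" using r by (rule permutes_inj)
  have g: "?g permutes {a, b, c}" using abc by (intro three_cycle_permutes_support)
  have fg: "f \<circ> ?g permutes {1..n}" using permutes_compose[OF permutes_subset[OF g abcn] f] .
  have rabc: "?r a = a" "?r b = c" "?r c = a + c - b" using abc by (auto simp: block_swap_def)
  have "(\<Union>t\<in>{a, a + c - b, c}. orbit ?f t) = (\<Union>t\<in>?r ` {a, b, c}. orbit ?f t)"
    using rabc by (simp add: Un_commute)
  also have "\<dots> = (\<Union>t\<in>{a, b, c}. ?r ` orbit (f \<circ> ?g) t)"
    unfolding reglue_def using orbit_conj_bij[OF permutes_bij[OF r], of "f \<circ> ?g"] by simp
  also have "\<dots> = ?r ` (\<Union>t\<in>{a, b, c}. orbit (f \<circ> ?g) t)" by blast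
  also have "\<dots> = ?r ` ?U" using orbits_comp[OF f g abcn] by simp
  finally have U': "(\<Union>t\<in>{a, a + c - b, c}. orbit ?f t) = ?r ` ?U" .
  have selfU: "{a, b, c} \<subseteq> ?U" using orbit_self[OF f] by blast
  have disj: "X \<inter> {a, b, c} = {}" if X: "X \<in> A" for X
  proof (rule ccontr)
    assume "X \<inter> {a, b, c} \<noteq> {}"
    then obtain t where t: "t \<in> X" "t \<in> {a, b, c}" by blast
    then have "X = orbit f t" using cycles_of_eq_orbit[OF f] A(1) X by blast
    then have "X \<subseteq> ?U" using t by blast
    then show False using A(3)[OF X] U by fastforce
  qed
  have A': "A \<subseteq> cycles_of n (f \<circ> ?g)"
    using cycles_disjoint_comp[OF f g order_refl abcn] disj A(1) by blast
  have "(\<Union>((`) ?r ` A) \<union> ?r ` ?U) = ?r ` (\<Union>A \<union> ?U)" by blast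
  then have "merged_type n ?f (\<Union>((`) ?r ` A) \<union> ?r ` ?U) = merged_type n (f \<circ> ?g) (\<Union>A \<union> ?U)"
    unfolding reglue_def using merged_type_conj[OF r] by simp
  also have "\<dots> = merged_type n f (\<Union>A \<union> ?U)"
    using selfU by (intro merged_type_comp[OF f g _ abcn]) blast
  finally have mt: "merged_type n ?f (\<Union>((`) ?r ` A) \<union> ?r ` ?U) = merged_type n f (\<Union>A \<union> ?U)" .
  have "\<exists>x\<in>?r ` X. x < a" if X: "X \<in> A" for X
  proof -
    obtain x where "x \<in> X" "x < a" using A(3)[OF X] by blast
    then have "?r x \<in> ?r ` X" "?r x < a" by (auto simp: block_swap_def)
    then show ?thesis by blast
  qed
  moreover have "card ((`) ?r ` A) = m"
    using card_image[OF inj_on_image_set[OF injr]] A(2) by simp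
  moreover have "(`) ?r ` A \<subseteq> cycles_of n ?f"
    unfolding reglue_def cycles_of_conj[OF r] using A' by blast
  moreover have "\<forall>x\<in>?r ` ?U. a \<le> x" using U abc by (auto simp: block_swap_def)
  moreover have "?f permutes {1..n}" using abc f by (intro reglue_permutes)
  moreover have "a < a + c - b" "a + c - b < c" using abc by auto
  moreover have "P (cycle_type n (codiag n ?f)) (merged_type n f (\<Union>A \<union> ?U))"
    using P cycle_type_codiag_reglue[OF abc(2,3,1,4) f] by simp
  ultimately show ?thesis
    unfolding config_def U' mt using abc(1,4) by (intro conjI) blast+
qed

section \<open>Gluing three cycles and cutting at a trisection\<close>

text \<open>The move exchanges the following two situations, in both of which \<open>a\<close> is minimal in its cycle.
  Split: \<open>a\<close> and \<open>b\<close> are the minima of two cycles and \<open>c\<close> is an anti-exceedance in a third cycle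
  whose minimum exceeds \<open>b\<close>. Merged: a single cycle passes through \<open>a\<close>, \<open>c\<close>, \<open>b\<close> in this order,
  \<open>b\<close> is an anti-exceedance, and \<open>c\<close> is the smallest element exceeding \<open>b\<close> on the way from
  \<open>a\<close> to \<open>b\<close>, hence determined by \<open>b\<close>.\<close>

definition split_triple :: "(nat \<Rightarrow> nat) \<Rightarrow> nat \<Rightarrow> nat \<Rightarrow> nat \<Rightarrow> bool" where
  "split_triple f a b c \<longleftrightarrow>
     (\<forall>x\<in>orbit f b. b \<le> x) \<and> (\<forall>x\<in>orbit f c. b < x) \<and> c \<le> inv f c"

definition merged_triple :: "(nat \<Rightarrow> nat) \<Rightarrow> nat \<Rightarrow> nat \<Rightarrow> nat \<Rightarrow> bool" where
  "merged_triple f a b c \<longleftrightarrow>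
     (\<exists>p q. 0 < p \<and> 0 < q \<and> (f ^^ p) a = c \<and> (f ^^ (p + q)) a = b
        \<and> (\<forall>i. 0 < i \<and> i \<le> p + q \<longrightarrow> (f ^^ i) a \<noteq> a)
        \<and> (\<forall>i\<le>p + q. (f ^^ i) a \<le> b \<or> c \<le> (f ^^ i) a)) \<and> b \<le> inv f b"

text \<open>The \<open>g\<close>-path from \<open>y\<close> follows the \<open>f\<close>-path from
  \<open>x\<close> as long as the two maps agree on the points met. Below, \<open>g\<close> is
  \<open>f\<close> times a three-cycle, which reroutes only the first step.\<close>

lemma funpow_shadow:
  assumes "g y = f x" "\<And>i. 0 < i \<Longrightarrow> i < r \<Longrightarrow> g ((f ^^ i) x) = f ((f ^^ i) x)"
    and "0 < i" "i \<le> r"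
  shows "(g ^^ i) y = (f ^^ i) x"
  using assms(3,4)
proof (induction i)
  case (Suc i)
  then show ?case using assms(1,2) by (cases "i = 0") auto
qed simp

text \<open>The indices are \<open>1, ..., r\<close> and not \<open>0, ..., r - 1\<close> to fit
  \<open>funpow_shadow\<close>, where the two paths may start at different points.\<close>

lemma orbit_of_period:
  assumes "f permutes {1..n::nat}" "0 < r" "(f ^^ r) x = x"
  shows "orbit f x = (\<lambda>i. (f ^^ i) x) ` {1..r}"
proof -
  have "y \<in> (\<lambda>i. (f ^^ i) x) ` {1..r}" if y: "y \<in> orbit f x" for y
  proof -
    obtain i where i: "y = (f ^^ i) x" using y in_orbit_iff_funpow[OF assms(1)] by blast
    then have i': "y = (f ^^ (i mod r)) x" using funpow_mod_eq[OF assms(3)] by metis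
    show ?thesis
    proof (cases "i mod r = 0")
      case True
      then have "y = (f ^^ r) x" using i' assms(3) by simp
      then show ?thesis using assms(2) by (intro image_eqI[of _ _ r]) auto
    next
      case False
      moreover have "i mod r < r" using assms(2) by simp
      ultimately show ?thesis using i' by (intro image_eqI[of _ _ "i mod r"]) auto
    qed
  qed
  moreover have "(f ^^ i) x \<in> orbit f x" for i using in_orbit_iff_funpow[OF assms(1)] by blast
  ultimately show ?thesis by blast
qed

text \<open>By injectivity of \<open>f\<close>, a repetition along the path can be moved back to its
  start, where it would be a return to \<open>a\<close>.\<close>

lemma funpow_eq_imp_eq:
  assumes f: "f permutes {1..n::nat}" and ne: "\<And>i. 0 < i \<Longrightarrow> i \<le> N \<Longrightarrow> (f ^^ i) a \<noteq> a"
    and "i \<le> N" "j \<le> N" "(f ^^ i) a = (f ^^ j) a"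
  shows "i = j"
proof -
  have le: "i = j" if "i \<le> j" "j \<le> N" "(f ^^ i) a = (f ^^ j) a" for i j
  proof (rule ccontr)
    assume "i \<noteq> j"
    have "(f ^^ i) ((f ^^ (j - i)) a) = (f ^^ i) a"
      using that by (simp flip: funpow_add comp_apply[of "f ^^ _" "f ^^ _"])
    moreover have "inj (f ^^ i)" using f by (simp add: bij_is_inj bij_fn permutes_bij)
    ultimately have "(f ^^ (j - i)) a = a" by (simp add: inj_eq)
    then show False using ne[of "j - i"] that \<open>i \<noteq> j\<close> by simp
  qed
  show ?thesis using le[of i j] le[of j i] assms by (metis nat_le_linear)
qed

lemma reglue_funpow:
  assumes "a < b" "b < c"
  shows "(reglue f a b c ^^ i) (block_swap a b c x) = block_swap a b c (((f \<circ> three_cycle a b c) ^^ i) x)"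
proof -
  have "inv (block_swap a b c) (block_swap a b c y) = y" for y
    using bij_block_swap[OF assms] by (simp add: bij_is_inj)
  then show ?thesis by (induction i) (simp_all add: reglue_def)
qed

lemma inv_reglue:
  assumes "a < b" "b < c" "1 \<le> a" "c \<le> n" "f permutes {1..n}" "f (three_cycle a b c y) = x"
  shows "inv (reglue f a b c) (block_swap a b c x) = block_swap a b c y"
proof -
  have "inv (block_swap a b c) (block_swap a b c y) = y"
    using bij_block_swap[OF assms(1,2)] by (simp add: bij_is_inj)
  then have "reglue f a b c (block_swap a b c y) = block_swap a b c x"
    using assms(6) by (simp add: reglue_def)
  then show ?thesis
    using reglue_permutes[OF assms(1-5)] by (metis permutes_inverses(2))
qed

text \<open>\<open>f \<circ> three_cycle a b c\<close> sends \<open>a\<close> to \<open>f b\<close>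
  and \<open>b\<close> to \<open>f c\<close>. From \<open>a\<close> it therefore runs through the
  whole cycle of \<open>b\<close>, ending in \<open>b\<close>, and then through the whole cycle of
  \<open>c\<close>, ending in \<open>c\<close>. The renaming turns \<open>b\<close> and
  \<open>c\<close> into \<open>c\<close> and \<open>a + c - b\<close>.\<close>

lemma merged_triple_reglue:
  assumes f: "f permutes {1..n}" and abc: "1 \<le> a" "a < b" "b < c" "c \<le> n"
    and U: "\<And>x. x \<in> orbit f a \<Longrightarrow> a \<le> x" and split: "split_triple f a b c"
  shows "merged_triple (reglue f a b c) a (a + c - b) c"
proof -
  let ?r = "block_swap a b c" and ?g = "three_cycle a b c" and ?f = "reglue f a b c"
  let ?h = "f \<circ> ?g"
  have b: "\<And>x. x \<in> orbit f b \<Longrightarrow> b \<le> x" and c: "\<And>x. x \<in> orbit f c \<Longrightarrow> b < x"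
    and inv: "c \<le> inv f c"
    using split by (auto simp: split_triple_def)
  have rabc: "?r a = a" "?r b = c" "?r c = a + c - b" using abc by (auto simp: block_swap_def)
  have h: "?h z = f z" if "z \<notin> {a, b, c}" for z using that by (simp add: three_cycle_def)
  have cnb: "c \<notin> orbit f b"
    using orbit_eq_orbit[OF f, of c b] c[of b] orbit_self[OF f, of b] by auto
  have least: "\<exists>r>0. (f ^^ r) x = x \<and> (\<forall>i. 0 < i \<and> i < r \<longrightarrow> (f ^^ i) x \<noteq> x)" for x
  proof -
    have "0 < least_power f x \<and> (f ^^ least_power f x) x = x"
      using least_power_of_permutation[OF permutes_permutation[OF f]] by blast
    then have ex: "\<exists>r>0. (f ^^ r) x = x" by blast
    define r where "r = (LEAST r. 0 < r \<and> (f ^^ r) x = x)"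
    have "0 < r \<and> (f ^^ r) x = x" unfolding r_def using ex by (rule LeastI_ex)
    moreover have "\<not> (0 < i \<and> (f ^^ i) x = x)" if "i < r" for i
      using that unfolding r_def by (rule not_less_Least)
    ultimately show ?thesis by blast
  qed
  obtain p where p: "p > 0" "(f ^^ p) b = b" "\<And>i. 0 < i \<Longrightarrow> i < p \<Longrightarrow> (f ^^ i) b \<noteq> b"
    using least[of b] by blast
  obtain q where q: "q > 0" "(f ^^ q) c = c" "\<And>i. 0 < i \<Longrightarrow> i < q \<Longrightarrow> (f ^^ i) c \<noteq> c"
    using least[of c] by blast
  have ob: "(f ^^ i) b \<in> orbit f b" and oc: "(f ^^ i) c \<in> orbit f c" for i
    using in_orbit_iff_funpow[OF f] by blast+
  have hb: "(?h ^^ i) a = (f ^^ i) b" if "0 < i" "i \<le> p" for i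
  proof (rule funpow_shadow[OF _ _ that])
    show "?h a = f b" by (simp add: three_cycle_def)
    fix i assume i: "0 < i" "i < p"
    have "(f ^^ i) b \<noteq> a" using b[OF ob[of i]] abc by auto
    moreover have "(f ^^ i) b \<noteq> c" using ob[of i] cnb by auto
    ultimately show "?h ((f ^^ i) b) = f ((f ^^ i) b)" using p(3)[OF i] by (intro h) auto
  qed
  have hc: "(?h ^^ i) b = (f ^^ i) c" if "0 < i" "i \<le> q" for i
  proof (rule funpow_shadow[OF _ _ that])
    show "?h b = f c" using abc by (simp add: three_cycle_def)
    fix i assume i: "0 < i" "i < q"
    show "?h ((f ^^ i) c) = f ((f ^^ i) c)" using c[OF oc[of i]] abc q(3)[OF i] by (intro h) auto
  qed
  have hpb: "(?h ^^ p) a = b" using hb[of p] p by simp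
  have hpq: "(?h ^^ (p + i)) a = (?h ^^ i) b" for i
    using hpb by (metis add.commute comp_apply funpow_add)
  have in_bc: "(?h ^^ i) a \<in> orbit f b \<union> orbit f c" if "0 < i" "i \<le> p + q" for i
  proof (cases "i \<le> p")
    case True
    then show ?thesis using hb[of i] that ob by simp
  next
    case False
    then have "(?h ^^ i) a = (f ^^ (i - p)) c" using hpq[of "i - p"] hc[of "i - p"] that by simp
    then show ?thesis using oc by simp
  qed
  \<comment> \<open>The renaming sends \<open>b\<close> to \<open>c\<close>, moves
    \<open>b+1 ... c\<close> down to \<open>a+1 ... a+c-b\<close> and fixes what is larger. So once
    all points met are at least \<open>b\<close>, no new value equals \<open>a\<close> or lies
    strictly between \<open>a + c - b\<close> and \<open>c\<close>.\<close>
  have geb: "b \<le> (?h ^^ i) a" if "0 < i" "i \<le> p + q" for i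
    using in_bc[OF that] by (elim UnE) (blast intro: b c less_imp_le)+
  have pow: "(?f ^^ i) a = ?r ((?h ^^ i) a)" for i
    using reglue_funpow[OF abc(2,3), where f = f and i = i and x = a] rabc by simp
  have "(?f ^^ p) a = c" using pow hpb rabc by simp
  moreover have "(?f ^^ (p + q)) a = a + c - b"
    using pow hpq[of q] hc[of q] q rabc by simp
  moreover have "(?f ^^ i) a \<noteq> a" if "0 < i" "i \<le> p + q" for i
    using geb[OF that] abc unfolding pow by (auto simp: block_swap_def)
  moreover have "(?f ^^ i) a \<le> a + c - b \<or> c \<le> (?f ^^ i) a" if "i \<le> p + q" for i
  proof (cases "i = 0")
    case True
    then show ?thesis using abc by simp
  next
    case False
    then show ?thesis using geb[of i] that abc unfolding pow by (auto simp: block_swap_def)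
  qed
  \<comment> \<open>The predecessor of \<open>c\<close> under
    \<open>f \<circ> three_cycle a b c\<close> is \<open>b\<close> if \<open>f\<close> fixes
    \<open>c\<close>. Otherwise it is still \<open>inv f c\<close>, which lies beyond
    \<open>c\<close> and is not renamed.\<close>
  moreover have "a + c - b \<le> inv ?f (a + c - b)"
  proof (cases "inv f c = c")
    case True
    then have "f (?g b) = c" using permutes_inverses(1)[OF f, of c] abc by (simp add: three_cycle_def)
    then have "inv ?f (?r c) = ?r b" by (rule inv_reglue[OF abc(2,3,1,4) f])
    then show ?thesis using rabc abc by simp
  next
    case False
    then have "c < inv f c" using inv by simp
    then have "f (?g (inv f c)) = c" "?r (inv f c) = inv f c"
      using permutes_inverses(1)[OF f, of c] abc by (simp_all add: three_cycle_def block_swap_def)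
    then have "inv ?f (?r c) = inv f c" using inv_reglue[OF abc(2,3,1,4) f] by metis
    then show ?thesis using rabc abc inv by simp
  qed
  ultimately show ?thesis unfolding merged_triple_def using p(1) q(1) by blast
qed

text \<open>\<open>f \<circ> three_cycle a b c\<close> sends \<open>c\<close> to \<open>f a\<close>
  and \<open>b\<close> to \<open>f c\<close>, so the stretches from \<open>f a\<close> to
  \<open>c\<close> and from \<open>f c\<close> to \<open>b\<close> close up into two cycles. No
  value on them lies strictly between \<open>b\<close> and \<open>c\<close>, hence after renaming
  the smallest value is \<open>a + c - b\<close>, the image of \<open>c\<close>, which lies in the
  first cycle.\<close>

lemma split_triple_reglue:
  assumes f: "f permutes {1..n}" and abc: "1 \<le> a" "a < b" "b < c" "c \<le> n"
    and U: "\<And>x. x \<in> orbit f a \<Longrightarrow> a \<le> x" and merged: "merged_triple f a b c"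
  shows "split_triple (reglue f a b c) a (a + c - b) c"
proof -
  let ?r = "block_swap a b c" and ?g = "three_cycle a b c" and ?f = "reglue f a b c"
  let ?h = "f \<circ> ?g"
  obtain p q where pq: "0 < p" "0 < q" "(f ^^ p) a = c" "(f ^^ (p + q)) a = b"
    and ne: "\<And>i. 0 < i \<Longrightarrow> i \<le> p + q \<Longrightarrow> (f ^^ i) a \<noteq> a"
    and gap: "\<And>i. i \<le> p + q \<Longrightarrow> (f ^^ i) a \<le> b \<or> c \<le> (f ^^ i) a"
    and inv: "b \<le> inv f b"
    using merged unfolding merged_triple_def by blast
  have rabc: "?r a = a" "?r b = c" "?r c = a + c - b" using abc by (auto simp: block_swap_def)
  have h: "?h z = f z" if "z \<notin> {a, b, c}" for z using that by (simp add: three_cycle_def)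
  have hp: "?h permutes {1..n}"
    using permutes_compose[OF three_cycle_permutes[OF abc(2,3,1,4)] f] .
  note uniq = funpow_eq_imp_eq[of f n "p + q" a, OF f ne]
  have fc: "(f ^^ i) c = (f ^^ (i + p)) a" for i using pq(3) by (simp add: funpow_add)
  have qb: "(f ^^ q) c = b" using pq(4) fc[of q] by (simp add: add.commute)
  have ge: "a \<le> (f ^^ i) a" for i using U in_orbit_iff_funpow[OF f] by blast
  have hc: "(?h ^^ i) c = (f ^^ i) a" if "0 < i" "i \<le> p" for i
  proof (rule funpow_shadow[OF _ _ that])
    show "?h c = f a" using abc by (simp add: three_cycle_def)
    fix i assume i: "0 < i" "i < p"
    have "(f ^^ i) a \<noteq> c" "(f ^^ i) a \<noteq> b"
      using uniq[of i p] uniq[of i "p + q"] pq i by auto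
    then show "?h ((f ^^ i) a) = f ((f ^^ i) a)" using ne[of i] i by (intro h) auto
  qed
  have hb: "(?h ^^ i) b = (f ^^ i) c" if "0 < i" "i \<le> q" for i
  proof (rule funpow_shadow[OF _ _ that])
    show "?h b = f c" using abc by (simp add: three_cycle_def)
    fix i assume i: "0 < i" "i < q"
    have "(f ^^ i) c \<noteq> c" "(f ^^ i) c \<noteq> b"
      using uniq[of p "i + p"] uniq[of "i + p" "p + q"] pq i fc by auto
    then show "?h ((f ^^ i) c) = f ((f ^^ i) c)"
      using ne[of "i + p"] i fc by (intro h) auto
  qed
  have orb: "orbit ?h c = (\<lambda>i. (f ^^ i) a) ` {1..p}"
  proof -
    have "(?h ^^ p) c = c" using hc[of p] pq by simp
    then have "orbit ?h c = (\<lambda>i. (?h ^^ i) c) ` {1..p}" by (rule orbit_of_period[OF hp pq(1)])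
    also have "\<dots> = (\<lambda>i. (f ^^ i) a) ` {1..p}" using hc by (intro image_cong) auto
    finally show ?thesis .
  qed
  have orb': "orbit ?h b = (\<lambda>i. (f ^^ i) c) ` {1..q}"
  proof -
    have "(?h ^^ q) b = b" using hb[of q] pq qb by simp
    then have "orbit ?h b = (\<lambda>i. (?h ^^ i) b) ` {1..q}" by (rule orbit_of_period[OF hp pq(2)])
    also have "\<dots> = (\<lambda>i. (f ^^ i) c) ` {1..q}" using hb by (intro image_cong) auto
    finally show ?thesis .
  qed
  have "\<forall>x\<in>orbit ?f (?r c). a + c - b \<le> x"
  proof
    fix x assume "x \<in> orbit ?f (?r c)"
    then have "x \<in> ?r ` (\<lambda>i. (f ^^ i) a) ` {1..p}"
      unfolding reglue_def orbit_conj_bij[OF bij_block_swap[OF abc(2,3)]] orb .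
    then obtain i where "i \<in> {1..p}" "x = ?r ((f ^^ i) a)" by blast
    then have i: "0 < i" "i \<le> p" "x = ?r ((f ^^ i) a)" by simp_all
    have "a < (f ^^ i) a" using ge[of i] ne[of i] i by simp
    moreover have "(f ^^ i) a \<le> b \<or> c \<le> (f ^^ i) a" using gap i by simp
    ultimately show "a + c - b \<le> x" unfolding i(3) using abc by (auto simp: block_swap_def)
  qed
  moreover have "\<forall>x\<in>orbit ?f (?r b). a + c - b < x"
  proof
    fix x assume "x \<in> orbit ?f (?r b)"
    then have "x \<in> ?r ` (\<lambda>i. (f ^^ i) c) ` {1..q}"
      unfolding reglue_def orbit_conj_bij[OF bij_block_swap[OF abc(2,3)]] orb' .
    then obtain i where "i \<in> {1..q}" "x = ?r ((f ^^ i) c)" by blast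
    then have i: "0 < i" "i \<le> q" "x = ?r ((f ^^ i) c)" by simp_all
    have "a < (f ^^ i) c" using ge[of "i + p"] ne[of "i + p"] i fc by simp
    moreover have "(f ^^ i) c \<le> b \<or> c \<le> (f ^^ i) c" using gap[of "i + p"] i fc by simp
    moreover have "(f ^^ i) c \<noteq> c" using uniq[of p "i + p"] pq i fc by auto
    ultimately show "a + c - b < x" unfolding i(3) using abc by (auto simp: block_swap_def)
  qed
  \<comment> \<open>The predecessor of \<open>b\<close> on the path is not \<open>b\<close>, so the
    gap condition puts it at or above \<open>c\<close>. If it is \<open>c\<close>, then
    \<open>f \<circ> three_cycle a b c\<close> fixes \<open>b\<close>; otherwise it is neither
    rerouted nor renamed.\<close>
  moreover have "c \<le> inv ?f c"
  proof -
    have w: "inv f b = (f ^^ (p + q - 1)) a"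
    proof -
      have "f ((f ^^ (p + q - 1)) a) = b" using pq by (metis Suc_diff_1 add_gr_0 comp_apply funpow.simps(2))
      then show ?thesis using permutes_inverses(2)[OF f] by metis
    qed
    have "inv f b \<noteq> b"
      using uniq[of "p + q - 1" "p + q"] pq w by auto
    moreover have "inv f b \<le> b \<or> c \<le> inv f b" unfolding w using gap by simp
    ultimately have cw: "c \<le> inv f b" using inv by simp
    show ?thesis
    proof (cases "inv f b = c")
      case True
      then have "f (?g b) = b" using permutes_inverses(1)[OF f, of b] abc by (simp add: three_cycle_def)
      then have "inv ?f (?r b) = ?r b" by (rule inv_reglue[OF abc(2,3,1,4) f])
      then show ?thesis using rabc by simp
    next
      case False
      then have "f (?g (inv f b)) = b" "?r (inv f b) = inv f b"
        using permutes_inverses(1)[OF f, of b] abc cw by (simp_all add: three_cycle_def block_swap_def)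
      then have "inv ?f (?r b) = inv f b" using inv_reglue[OF abc(2,3,1,4) f] by metis
      then show ?thesis using rabc cw by simp
    qed
  qed
  ultimately show ?thesis unfolding split_triple_def rabc by blast
qed

section \<open>Iterating the bijection\<close>

definition merged_configs where
  "merged_configs n m P = {(f, A, a, b, c). config n m P f A a b c \<and> merged_triple f a b c}"

definition split_configs where
  "split_configs n m P = {(f, A, a, b, c). config n m P f A a b c \<and> split_triple f a b c}"

lemma config_reglue_reglue:
  assumes "config n m P f A a b c"
  shows "reglue (reglue f a b c) a (a + c - b) c = f"
    "(`) (block_swap a (a + c - b) c) ` (`) (block_swap a b c) ` A = A"
    "a + c - (a + c - b) = b"
proof -
  have abc: "a < b" "b < c" using assms by (auto simp: config_def)
  show "reglue (reglue f a b c) a (a + c - b) c = f" by (rule reglue_involution[OF abc])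
  show "(`) (block_swap a (a + c - b) c) ` (`) (block_swap a b c) ` A = A"
    by (simp add: image_image block_swap_inverse[OF abc])
  show "a + c - (a + c - b) = b" using abc by simp
qed

lemma config_merged_triple_reglue:
  assumes "config n m P f A a b c" "split_triple f a b c"
  shows "merged_triple (reglue f a b c) a (a + c - b) c"
  by (rule merged_triple_reglue[of f n]) (use assms in \<open>auto simp: config_def\<close>)

lemma config_split_triple_reglue:
  assumes "config n m P f A a b c" "merged_triple f a b c"
  shows "split_triple (reglue f a b c) a (a + c - b) c"
  by (rule split_triple_reglue[of f n]) (use assms in \<open>auto simp: config_def\<close>)

text \<open>The move, its own inverse on configurations, carries each of the two situations into the
  other.\<close>

lemma card_merged_configs_eq_split_configs: "card (merged_configs n m P) = card (split_configs n m P)"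
proof -
  define G :: "(nat \<Rightarrow> nat) \<times> nat set set \<times> nat \<times> nat \<times> nat \<Rightarrow> _"
    where "G = (\<lambda>(f, A, a, b, c). (reglue f a b c, (`) (block_swap a b c) ` A, a, a + c - b, c))"
  have GG: "G (G (f, A, a, b, c)) = (f, A, a, b, c)" if "config n m P f A a b c" for f A a b c
    unfolding G_def prod.case config_reglue_reglue[OF that] ..
  have "bij_betw G (merged_configs n m P) (split_configs n m P)"
  proof (rule bij_betw_byWitness[where f' = G])
    show "\<forall>x\<in>merged_configs n m P. G (G x) = x" "\<forall>x\<in>split_configs n m P. G (G x) = x"
      using GG by (auto simp: merged_configs_def split_configs_def)
    show "G ` merged_configs n m P \<subseteq> split_configs n m P"
      using config_reglue config_split_triple_reglue
      by (auto simp: G_def merged_configs_def split_configs_def)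
    show "G ` split_configs n m P \<subseteq> merged_configs n m P"
      using config_reglue config_merged_triple_reglue
      by (auto simp: G_def merged_configs_def split_configs_def)
  qed
  then show ?thesis by (rule bij_betw_same_card)
qed

text \<open>The anti-exceedance \<open>z\<close> is the mark. Its cycle has a larger minimum than
  the cycles in \<open>A\<close>, so the order in which cycles were split off can be read from their
  minima and \<open>A\<close> may be an unordered set.\<close>

definition marked ::
  "nat \<Rightarrow> nat \<Rightarrow> (nat multiset \<Rightarrow> nat multiset \<Rightarrow> bool) \<Rightarrow> ((nat \<Rightarrow> nat) \<times> nat set set \<times> nat) set" where
  "marked n m P = {(f, A, z). f permutes {1..n} \<and> z \<in> {1..n} \<and> z \<le> inv f z \<and>
     A \<subseteq> cycles_of n f \<and> card A = m \<and> (\<forall>X\<in>A. Min X < Min (orbit f z)) \<and>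
     P (cycle_type n (codiag n f)) (merged_type n f (\<Union>A \<union> orbit f z))}"

definition nontrivially_marked where
  "nontrivially_marked n m P = {(f, A, z) \<in> marked n m P. z \<noteq> Min (orbit f z)}"

definition chosen_cycles ::
  "nat \<Rightarrow> nat \<Rightarrow> (nat multiset \<Rightarrow> nat multiset \<Rightarrow> bool) \<Rightarrow> ((nat \<Rightarrow> nat) \<times> nat set set) set" where
  "chosen_cycles n j P = {(f, B). f permutes {1..n} \<and> B \<subseteq> cycles_of n f \<and> card B = j \<and>
     P (cycle_type n (codiag n f)) (merged_type n f (\<Union>B))}"

lemma finite_perm_cycle_sets:
  "finite {(f, A). f permutes {1..n} \<and> A \<subseteq> cycles_of n f}"
proof (rule finite_subset)
  show "{(f, A). f permutes {1..n} \<and> A \<subseteq> cycles_of n f}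
    \<subseteq> {f. f permutes {1..n}} \<times> Pow (Pow {1..n})"
    using cycles_of_subset by fastforce
qed (simp add: finite_permutations)

lemma finite_marked: "finite (marked n m P)"
proof (rule finite_subset)
  show "marked n m P \<subseteq> (\<lambda>((f, A), z). (f, A, z)) `
      ({(f, A). f permutes {1..n} \<and> A \<subseteq> cycles_of n f} \<times> {1..n})"
  proof (clarsimp simp only: marked_def)
    fix f A z
    assume "f permutes {1..n}" "A \<subseteq> cycles_of n f" "z \<in> {1..n}"
    then show "(f, A, z) \<in> (\<lambda>((f, A), z). (f, A, z)) `
      ({(f, A). f permutes {1..n} \<and> A \<subseteq> cycles_of n f} \<times> {1..n})"
      by (intro image_eqI[of _ _ "((f, A), z)"]) auto
  qed
qed (intro finite_imageI finite_cartesian_product finite_perm_cycle_sets, simp)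

section \<open>Ordering cycles by their minima\<close>

lemma orbit_Min:
  assumes "f permutes {1..n::nat}" "x \<in> {1..n}"
  shows "finite (orbit f x)" "Min (orbit f x) \<in> orbit f x" "Min (orbit f x) \<in> {1..n}"
    "orbit f (Min (orbit f x)) = orbit f x" "Min (orbit f x) \<le> x"
proof -
  have c: "orbit f x \<in> cycles_of n f" using assms by (auto simp: cycles_of_def)
  show fin: "finite (orbit f x)" using cycles_of_finite[OF assms(1) c] by simp
  show m: "Min (orbit f x) \<in> orbit f x" using fin by (simp add: orbit_nonempty Min_in)
  then show "Min (orbit f x) \<in> {1..n}" using cycles_of_subset[OF assms(1) c] by blast
  show "orbit f (Min (orbit f x)) = orbit f x" using orbit_eq_orbit[OF assms(1) m] .
  show "Min (orbit f x) \<le> x" using fin orbit_self[OF assms(1)] by simp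
qed

text \<open>The cycle with the largest minimum is the one added last, so this is how a set of cycles
  is decoded.\<close>

lemma top_cycle:
  assumes f: "f permutes {1..n}" and A: "A \<subseteq> cycles_of n f" "A \<noteq> {}"
  defines "b \<equiv> Max (Min ` A)"
  shows "orbit f b \<in> A" "Min (orbit f b) = b" "b \<in> {1..n}"
    "\<And>X. X \<in> A \<Longrightarrow> X \<noteq> orbit f b \<Longrightarrow> Min X < b"
proof -
  have fin: "finite A" using A finite_subset by fastforce
  then have "b \<in> Min ` A" unfolding b_def using A by (intro Max_in) auto
  then obtain X where X: "X \<in> A" "b = Min X" by blast
  then have "X \<in> cycles_of n f" using A by blast
  then obtain x where x: "x \<in> {1..n}" "X = orbit f x" unfolding cycles_of_def by blast
  show o: "orbit f b \<in> A" and m: "Min (orbit f b) = b" and "b \<in> {1..n}"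
    using orbit_Min[OF f x(1)] X x by auto
  fix Y assume Y: "Y \<in> A" "Y \<noteq> orbit f b"
  then have "Min Y \<le> b" unfolding b_def using fin by simp
  moreover have "Min Y \<noteq> b"
  proof
    assume "Min Y = b"
    then have "b \<in> Y" using cycles_of_finite[OF f] Y A Min_in by blast
    then show False using cycles_of_eq_orbit[OF f] Y A by blast
  qed
  ultimately show "Min Y < b" by simp
qed

lemma Max_Min_insert:
  assumes "finite A" "\<And>X. X \<in> A \<Longrightarrow> Min X < Min Y"
  shows "Max (Min ` insert Y A) = Min Y"
  using assms by (intro Max_eqI) (auto intro: less_imp_le)

lemma config_below:
  assumes "config n m P f A a b c" "X \<in> A"
  shows "Min X < a"
proof -
  have f: "f permutes {1..n}" and "X \<in> cycles_of n f" "\<exists>x\<in>X. x < a"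
    using assms by (auto simp: config_def)
  then show ?thesis using cycles_of_finite[OF f] by (simp add: Min_less_iff)
qed

lemma config_Min_orbit:
  assumes "config n m P f A a b c"
  shows "Min (orbit f a) = a"
proof -
  have f: "f permutes {1..n}" and "a \<in> {1..n}" "\<And>x. x \<in> orbit f a \<Longrightarrow> a \<le> x"
    using assms by (auto simp: config_def)
  then show ?thesis using orbit_Min[OF f] orbit_self[OF f, of a] by (intro Min_eqI) auto
qed

lemma config_split_facts:
  assumes c: "config n m P f A a b c" and s: "split_triple f a b c"
  shows "Min (orbit f b) = b" "b < Min (orbit f c)" "orbit f b \<notin> insert (orbit f a) A" "orbit f a \<notin> A"
proof -
  have f: "f permutes {1..n}" and abc: "a \<in> {1..n}" "b \<in> {1..n}" "c \<in> {1..n}" "a < b"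
    using c by (auto simp: config_def)
  show b: "Min (orbit f b) = b"
    using s orbit_Min[OF f abc(2)] orbit_self[OF f, of b] by (intro Min_eqI) (auto simp: split_triple_def)
  show "b < Min (orbit f c)"
    using s orbit_Min[OF f abc(3)] by (auto simp: split_triple_def)
  show "orbit f b \<notin> insert (orbit f a) A"
    using b config_Min_orbit[OF c] config_below[OF c] abc(4) by force
  show "orbit f a \<notin> A"
    using config_Min_orbit[OF c] config_below[OF c] by force
qed

text \<open>The cycles of \<open>a\<close> and \<open>b\<close> join \<open>A\<close>, and
  \<open>c\<close> becomes the mark. As the minima in \<open>A\<close> lie below \<open>a\<close>
  and \<open>a < b\<close>, the two cycles are recovered by twice removing the cycle with the
  largest minimum, as \<open>H\<close> does.\<close>

lemma card_split_configs_eq_marked: "card (split_configs n m P) = card (marked n (m + 2) P)"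
proof -
  define F :: "(nat \<Rightarrow> nat) \<times> nat set set \<times> nat \<times> nat \<times> nat \<Rightarrow> (nat \<Rightarrow> nat) \<times> nat set set \<times> nat"
    where "F = (\<lambda>(f, A, a, b, c). (f, insert (orbit f b) (insert (orbit f a) A), c))"
  define H :: "(nat \<Rightarrow> nat) \<times> nat set set \<times> nat \<Rightarrow> (nat \<Rightarrow> nat) \<times> nat set set \<times> nat \<times> nat \<times> nat"
    where "H = (\<lambda>(f, A, z). let b = Max (Min ` A); Y = A - {orbit f b}; a = Max (Min ` Y)
      in (f, Y - {orbit f a}, a, b, z))"
  have HF: "H (F (f, A, a, b, c)) = (f, A, a, b, c)" and F: "F (f, A, a, b, c) \<in> marked n (m + 2) P"
    if conf: "config n m P f A a b c" and split: "split_triple f a b c" for f A a b c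
  proof -
    have f: "f permutes {1..n}" and abc: "a \<in> {1..n}" "b \<in> {1..n}" "c \<in> {1..n}" "a < b" "b < c"
      and A: "A \<subseteq> cycles_of n f" "card A = m"
      and P: "P (cycle_type n (codiag n f)) (merged_type n f (\<Union>A \<union> (\<Union>t\<in>{a, b, c}. orbit f t)))"
      using conf by (auto simp: config_def)
    have fin: "finite A" using A finite_subset by fastforce
    note ma = config_Min_orbit[OF conf] and below = config_below[OF conf]
    note facts = config_split_facts[OF conf split]
    have below': "Min X < b" if "X \<in> insert (orbit f a) A" for X
      using that below[of X] ma abc by force
    have "Max (Min ` insert (orbit f b) (insert (orbit f a) A)) = Min (orbit f b)"
      using below' facts(1) fin by (intro Max_Min_insert) auto
    moreover have "Max (Min ` insert (orbit f a) A) = Min (orbit f a)"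
      using below ma fin by (intro Max_Min_insert) auto
    moreover have "insert (orbit f b) (insert (orbit f a) A) - {orbit f b} = insert (orbit f a) A"
      using facts(3) by blast
    ultimately show "H (F (f, A, a, b, c)) = (f, A, a, b, c)"
      using facts ma by (simp add: H_def F_def Let_def)
    have "\<Union>(insert (orbit f b) (insert (orbit f a) A)) \<union> orbit f c
        = \<Union>A \<union> (\<Union>t\<in>{a, b, c}. orbit f t)" by blast
    moreover have "Min X < Min (orbit f c)" if "X \<in> insert (orbit f b) (insert (orbit f a) A)" for X
    proof -
      have "Min X \<le> b" using that below'[of X] facts(1) by (cases "X = orbit f b") auto
      then show ?thesis using facts(2) by simp
    qed
    moreover have "card (insert (orbit f b) (insert (orbit f a) A)) = m + 2"
      using facts(3,4) fin A(2) by simp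
    moreover have "insert (orbit f b) (insert (orbit f a) A) \<subseteq> cycles_of n f"
      using A(1) abc by (auto simp: cycles_of_def)
    moreover have "c \<le> inv f c" using split by (simp add: split_triple_def)
    ultimately show "F (f, A, a, b, c) \<in> marked n (m + 2) P"
      using f abc(3) P unfolding F_def marked_def prod.case mem_Collect_eq by metis
  qed
  have FH: "F (H (f, A, z)) = (f, A, z)" and H: "H (f, A, z) \<in> split_configs n m P"
    if "(f, A, z) \<in> marked n (m + 2) P" for f A z
  proof -
    have f: "f permutes {1..n}" and z: "z \<in> {1..n}" "z \<le> inv f z"
      and A: "A \<subseteq> cycles_of n f" "card A = m + 2" and lt: "\<And>X. X \<in> A \<Longrightarrow> Min X < Min (orbit f z)"
      and P: "P (cycle_type n (codiag n f)) (merged_type n f (\<Union>A \<union> orbit f z))"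
      using that by (auto simp: marked_def)
    have fin: "finite A" using A finite_subset by fastforce
    define b Y a where "b = Max (Min ` A)" and "Y = A - {orbit f b}" and "a = Max (Min ` Y)"
    have Hz: "H (f, A, z) = (f, Y - {orbit f a}, a, b, z)"
      by (simp add: H_def Let_def b_def Y_def a_def)
    have "A \<noteq> {}" using A by auto
    note b = top_cycle[OF f A(1) this, folded b_def]
    have Yc: "card Y = m + 1" unfolding Y_def using A b(1) fin by simp
    have Y: "Y \<subseteq> cycles_of n f" using A by (auto simp: Y_def)
    have "Y \<noteq> {}" using Yc by auto
    note a = top_cycle[OF f Y this, folded a_def]
    have ab: "a < b" using a(1,2) b(4)[of "orbit f a"] by (simp add: Y_def)
    have eq: "insert (orbit f b) (insert (orbit f a) (Y - {orbit f a})) = A"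
      using a(1) b(1) by (auto simp: Y_def)
    show "F (H (f, A, z)) = (f, A, z)" unfolding Hz by (simp add: F_def eq del: insert_Diff_single)
    have bz: "b < Min (orbit f z)" using lt[OF b(1)] b(2) by simp
    have gez: "b < x" if "x \<in> orbit f z" for x
      using bz orbit_Min(1)[OF f z(1)] that by (meson Min_le less_le_trans)
    have geb: "b \<le> x" if "x \<in> orbit f b" for x
      using b(2) orbit_Min(1)[OF f b(3)] that by (metis Min_le)
    have gea: "a \<le> x" if "x \<in> orbit f a" for x
      using a(2) orbit_Min(1)[OF f a(3)] that by (metis Min_le)
    have bz': "b < z" using gez orbit_self[OF f] by blast
    have below: "\<exists>x\<in>X. x < a" if "X \<in> Y - {orbit f a}" for X
    proof -
      have "Min X < a" using a(4) that by blast
      moreover have "Min X \<in> X" using cycles_of_finite[OF f, of X] that Y by (intro Min_in) auto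
      ultimately show ?thesis by blast
    qed
    have un: "\<Union>(Y - {orbit f a}) \<union> (\<Union>t\<in>{a, b, z}. orbit f t) = \<Union>A \<union> orbit f z"
      using eq by blast
    have all: "\<forall>x\<in>(\<Union>t\<in>{a, b, z}. orbit f t). a \<le> x"
      using gea geb gez ab by fastforce
    have "config n m P f (Y - {orbit f a}) a b z"
      unfolding config_def un using f a(3) ab bz' z Y Yc a(1) P below all by auto
    moreover have "split_triple f a b z" using geb gez z by (simp add: split_triple_def)
    ultimately show "H (f, A, z) \<in> split_configs n m P" unfolding Hz by (simp add: split_configs_def)
  qed
  have "bij_betw F (split_configs n m P) (marked n (m + 2) P)"
  proof (rule bij_betw_byWitness[where f' = H])
    show "\<forall>x\<in>split_configs n m P. H (F x) = x"
      using HF by (auto simp: split_configs_def simp del: split_paired_All)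
    show "\<forall>x\<in>marked n (m + 2) P. F (H x) = x" using FH by force
    show "F ` split_configs n m P \<subseteq> marked n (m + 2) P" using F by (auto simp: split_configs_def)
    show "H ` marked n (m + 2) P \<subseteq> split_configs n m P" using H by force
  qed
  then show ?thesis by (rule bij_betw_same_card)
qed

section \<open>Merged configurations as marked non-trivial anti-exceedances\<close>

lemma merged_triple_orbits:
  assumes f: "f permutes {1..n}" and "merged_triple f a b c"
  shows "orbit f b = orbit f a" "orbit f c = orbit f a"
  using assms in_orbit_iff_funpow[OF f] orbit_eq_orbit[OF f] unfolding merged_triple_def by metis+

text \<open>Both triples describe the same path from \<open>a\<close> to \<open>b\<close>, and
  \<open>c\<close> and \<open>c'\<close> are both the smallest value above \<open>b\<close> on
  it.\<close>

lemma merged_triple_unique: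
  assumes f: "f permutes {1..n}" and b: "b < c" "b < c'"
    and "merged_triple f a b c" "merged_triple f a b c'"
  shows "c = c'"
proof -
  obtain p q where pq: "0 < p" "0 < q" "(f ^^ p) a = c" "(f ^^ (p + q)) a = b"
    and ne: "\<And>i. 0 < i \<Longrightarrow> i \<le> p + q \<Longrightarrow> (f ^^ i) a \<noteq> a"
    and gap: "\<And>i. i \<le> p + q \<Longrightarrow> (f ^^ i) a \<le> b \<or> c \<le> (f ^^ i) a"
    using assms(4) unfolding merged_triple_def by blast
  obtain p' q' where pq': "0 < p'" "0 < q'" "(f ^^ p') a = c'" "(f ^^ (p' + q')) a = b"
    and ne': "\<And>i. 0 < i \<Longrightarrow> i \<le> p' + q' \<Longrightarrow> (f ^^ i) a \<noteq> a"
    and gap': "\<And>i. i \<le> p' + q' \<Longrightarrow> (f ^^ i) a \<le> b \<or> c' \<le> (f ^^ i) a"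
    using assms(5) unfolding merged_triple_def by blast
  \<comment> \<open>A path without return to \<open>a\<close> reaches \<open>b\<close> only
    once.\<close>
  have "p + q = p' + q'"
  proof (cases "p + q \<le> p' + q'")
    case True
    show ?thesis
      by (rule funpow_eq_imp_eq[of f n "p' + q'" a "p + q" "p' + q'"]) (use True f ne' pq pq' in simp_all)
  next
    case False
    show ?thesis
      by (rule funpow_eq_imp_eq[of f n "p + q" a "p + q" "p' + q'"]) (use False f ne pq pq' in simp_all)
  qed
  then have "p \<le> p' + q'" "p' \<le> p + q" by simp_all
  then have "c \<le> b \<or> c' \<le> c" "c' \<le> b \<or> c \<le> c'" using gap[of p'] gap'[of p] pq pq' by simp_all
  then show ?thesis using b by linarith
qed

text \<open>The witness is the smallest value above \<open>z\<close> on the path from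
  \<open>a\<close> to its first arrival at \<open>z\<close>. The predecessor of \<open>z\<close> is
  such a value: \<open>z\<close> is an anti-exceedance and, not being the minimum of its cycle, no
  fixed point.\<close>

lemma merged_triple_exists:
  assumes f: "f permutes {1..n}" and z: "z \<in> {1..n}" "z \<le> inv f z" "z \<noteq> Min (orbit f z)"
  defines "a \<equiv> Min (orbit f z)"
  shows "\<exists>c. c \<le> n \<and> z < c \<and> merged_triple f a z c"
proof -
  note Min = orbit_Min[OF f z(1), folded a_def]
  have "z \<in> orbit f a" using orbit_self[OF f] Min(4) by simp
  then have ex: "\<exists>i. (f ^^ i) a = z" using in_orbit_iff_funpow[OF f] by metis
  define N where "N = (LEAST i. (f ^^ i) a = z)"
  have N: "(f ^^ N) a = z" unfolding N_def using ex by (rule LeastI_ex)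
  have least: "(f ^^ i) a \<noteq> z" if "i < N" for i
    using that unfolding N_def by (rule not_less_Least)
  have "N \<noteq> 0"
  proof
    assume "N = 0"
    then show False using N z(3) by (simp add: a_def)
  qed
  have ne: "(f ^^ i) a \<noteq> a" if "0 < i" "i \<le> N" for i
  proof
    assume a: "(f ^^ i) a = a"
    have "(f ^^ (N - i)) a = (f ^^ (N - i)) ((f ^^ i) a)" using a by simp
    also have "\<dots> = z" using N that by (simp flip: funpow_add comp_apply[of "f ^^ _" "f ^^ _"])
    finally show False using least[of "N - i"] that by simp
  qed
  define S where "S = {i. i \<le> N \<and> z < (f ^^ i) a}"
  have w: "inv f z = (f ^^ (N - 1)) a"
  proof -
    have "f ((f ^^ (N - 1)) a) = z"
      using N \<open>N \<noteq> 0\<close> by (metis Suc_diff_1 comp_apply funpow.simps(2) neq0_conv)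
    then show ?thesis using permutes_inverses(2)[OF f] by metis
  qed
  have "(f ^^ (N - 1)) a \<noteq> z" using least[of "N - 1"] \<open>N \<noteq> 0\<close> by simp
  then have S: "N - 1 \<in> S" using z(2) w by (simp add: S_def)
  define p where "p = (ARG_MIN (\<lambda>i. (f ^^ i) a) i. i \<in> S)"
  have p: "p \<in> S" and pmin: "\<And>i. i \<in> S \<Longrightarrow> (f ^^ p) a \<le> (f ^^ i) a"
    using arg_min_nat_lemma[of "\<lambda>i. i \<in> S", OF S, of "\<lambda>i. (f ^^ i) a"] unfolding p_def by auto
  \<comment> \<open>The ends of the path carry \<open>z\<close> and \<open>a \<le> z\<close>, so the
    minimiser is an inner point.\<close>
  have "p \<noteq> N" using p N by (auto simp: S_def)
  moreover have "p \<noteq> 0"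
  proof
    assume "p = 0"
    then show False using p Min(5) by (simp add: S_def)
  qed
  ultimately have pN: "p \<noteq> N" "p \<noteq> 0" by auto
  have "(f ^^ p) a \<in> orbit f a" using in_orbit_iff_funpow[OF f] by blast
  moreover have "orbit f a \<subseteq> {1..n}" using permutes_orbit_subset[OF f Min(3)] .
  ultimately have "(f ^^ p) a \<le> n" by auto
  moreover have "z < (f ^^ p) a" using p by (simp add: S_def)
  moreover have "merged_triple f a z ((f ^^ p) a)"
    unfolding merged_triple_def
  proof (intro conjI exI)
    show "0 < p" using pN by simp
    show "0 < N - p" using p pN by (simp add: S_def)
    have pN': "p + (N - p) = N" using p by (simp add: S_def)
    show "(f ^^ (p + (N - p))) a = z" using N pN' by simp
    show "\<forall>i. 0 < i \<and> i \<le> p + (N - p) \<longrightarrow> (f ^^ i) a \<noteq> a" using ne pN' by simp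
    show "\<forall>i\<le>p + (N - p). (f ^^ i) a \<le> z \<or> (f ^^ p) a \<le> (f ^^ i) a"
      unfolding pN' using pmin unfolding S_def mem_Collect_eq by (meson not_le)
  qed (use z in auto)
  ultimately show ?thesis by blast
qed

text \<open>The point \<open>b\<close> determines the triple: \<open>a\<close> is the minimum of its
  cycle and \<open>c\<close> is unique. Every non-trivial mark occurs by
  \<open>merged_triple_exists\<close>.\<close>

lemma card_merged_configs_eq_nontrivially_marked: "card (merged_configs n m P) = card (nontrivially_marked n m P)"
proof -
  define F :: "(nat \<Rightarrow> nat) \<times> nat set set \<times> nat \<times> nat \<times> nat \<Rightarrow> (nat \<Rightarrow> nat) \<times> nat set set \<times> nat"
    where "F = (\<lambda>(f, A, a, b, c). (f, A, b))"
  have un: "(\<Union>t\<in>{a, b, c}. orbit f t) = orbit f b"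
    if "f permutes {1..n}" "merged_triple f a b c" for f a b c
    using merged_triple_orbits[OF that] by simp
  have "inj_on F (merged_configs n m P)"
  proof (rule inj_onI)
    fix x y assume xy: "x \<in> merged_configs n m P" "y \<in> merged_configs n m P" "F x = F y"
    obtain f A a b c where x: "x = (f, A, a, b, c)" by (cases x)
    obtain a' c' where y: "y = (f, A, a', b, c')" using xy(3) x by (cases y) (auto simp: F_def)
    have c: "config n m P f A a b c" "config n m P f A a' b c'"
      and m: "merged_triple f a b c" "merged_triple f a' b c'"
      using xy x y by (auto simp: merged_configs_def)
    then have f: "f permutes {1..n}" and bc: "b < c" "b < c'" by (auto simp: config_def)
    have "a = a'"
      using config_Min_orbit[OF c(1)] config_Min_orbit[OF c(2)]
        merged_triple_orbits(1)[OF f m(1)] merged_triple_orbits(1)[OF f m(2)] by simp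
    moreover have "c = c'"
      using merged_triple_unique[OF f bc m(1)] m(2) unfolding \<open>a = a'\<close> .
    ultimately show "x = y" unfolding x y by simp
  qed
  moreover have "F ` merged_configs n m P = nontrivially_marked n m P"
  proof
    show "F ` merged_configs n m P \<subseteq> nontrivially_marked n m P"
    proof (rule image_subsetI)
      fix x assume "x \<in> merged_configs n m P"
      then obtain f A a b c where x: "x = (f, A, a, b, c)" and c: "config n m P f A a b c" and m: "merged_triple f a b c"
        by (auto simp: merged_configs_def)
      then have f: "f permutes {1..n}" by (simp add: config_def)
      have Min: "Min (orbit f b) = a"
        using config_Min_orbit[OF c] merged_triple_orbits(1)[OF f m] by simp
      have "b \<le> inv f b" using m by (simp add: merged_triple_def)
      moreover have "b \<in> {1..n}" "b \<noteq> a" using c by (auto simp: config_def)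
      moreover have "A \<subseteq> cycles_of n f" "card A = m"
          "P (cycle_type n (codiag n f)) (merged_type n f (\<Union>A \<union> orbit f b))"
        using c unfolding config_def un[OF f m] by blast+
      ultimately show "F x \<in> nontrivially_marked n m P"
        unfolding x F_def nontrivially_marked_def marked_def prod.case mem_Collect_eq Min
        using f config_below[OF c] by blast
    qed
    show "nontrivially_marked n m P \<subseteq> F ` merged_configs n m P"
    proof clarify
      fix f A z assume "(f, A, z) \<in> nontrivially_marked n m P"
      then have f: "f permutes {1..n}" and z: "z \<in> {1..n}" "z \<le> inv f z" "z \<noteq> Min (orbit f z)"
        and A: "A \<subseteq> cycles_of n f" "card A = m" "\<And>X. X \<in> A \<Longrightarrow> Min X < Min (orbit f z)"
        and P: "P (cycle_type n (codiag n f)) (merged_type n f (\<Union>A \<union> orbit f z))"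
        by (auto simp: nontrivially_marked_def marked_def)
      define a where "a = Min (orbit f z)"
      obtain c where c: "c \<le> n" "z < c" and m: "merged_triple f a z c"
        using merged_triple_exists[OF f z] by (auto simp: a_def)
      note Min = orbit_Min[OF f z(1), folded a_def]
      have "a < z" using Min(5) z(3) by (simp add: a_def)
      moreover have "\<exists>x\<in>X. x < a" if X: "X \<in> A" for X
      proof -
        have "Min X \<in> X" using cycles_of_finite[OF f, of X] X A(1) by (intro Min_in) auto
        then show ?thesis using A(3)[OF X] by (auto simp: a_def)
      qed
      moreover have "a \<le> x" if "x \<in> orbit f z" for x using Min(1) that by (simp add: a_def)
      ultimately have "config n m P f A a z c"
        unfolding config_def un[OF f m] using f A(1,2) P c Min(3) by (intro conjI ballI) auto
      then have "(f, A, a, z, c) \<in> merged_configs n m P" using m by (simp add: merged_configs_def)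
      then show "(f, A, z) \<in> F ` merged_configs n m P" by (force simp: F_def)
    qed
  qed
  ultimately have "bij_betw F (merged_configs n m P) (nontrivially_marked n m P)"
    by (simp add: bij_betw_def)
  then show ?thesis by (rule bij_betw_same_card)
qed

text \<open>A marked minimum stands for its cycle; once this joins \<open>A\<close>, it is the cycle
  with the largest minimum.\<close>

lemma card_trivially_marked_eq_chosen_cycles:
  "card {(f, A, z) \<in> marked n m P. z = Min (orbit f z)} = card (chosen_cycles n (m + 1) P)"
proof -
  let ?M = "{(f, A, z) \<in> marked n m P. z = Min (orbit f z)}"
  define F :: "(nat \<Rightarrow> nat) \<times> nat set set \<times> nat \<Rightarrow> (nat \<Rightarrow> nat) \<times> nat set set"
    where "F = (\<lambda>(f, A, z). (f, insert (orbit f z) A))"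
  define H :: "(nat \<Rightarrow> nat) \<times> nat set set \<Rightarrow> (nat \<Rightarrow> nat) \<times> nat set set \<times> nat"
    where "H = (\<lambda>(f, B). (f, B - {orbit f (Max (Min ` B))}, Max (Min ` B)))"
  have HF: "H (F (f, A, z)) = (f, A, z)" and F: "F (f, A, z) \<in> chosen_cycles n (m + 1) P"
    if "(f, A, z) \<in> ?M" for f A z
  proof -
    have f: "f permutes {1..n}" and z: "z \<in> {1..n}" "Min (orbit f z) = z"
      and A: "A \<subseteq> cycles_of n f" "card A = m" and lt: "\<And>X. X \<in> A \<Longrightarrow> Min X < Min (orbit f z)"
      and P: "P (cycle_type n (codiag n f)) (merged_type n f (\<Union>A \<union> orbit f z))"
      using that by (auto simp: marked_def)
    have fin: "finite A" using A finite_subset by fastforce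
    have notin: "orbit f z \<notin> A" using lt by blast
    have "Max (Min ` insert (orbit f z) A) = z"
      using Max_Min_insert[OF fin, of "orbit f z"] lt z(2) by simp
    then show "H (F (f, A, z)) = (f, A, z)" using notin by (simp add: F_def H_def)
    have "\<Union>(insert (orbit f z) A) = \<Union>A \<union> orbit f z" by blast
    then show "F (f, A, z) \<in> chosen_cycles n (m + 1) P"
      using f A z(1) P notin fin by (auto simp: F_def chosen_cycles_def cycles_of_def Un_commute)
  qed
  have FH: "F (H (f, B)) = (f, B)" and H: "H (f, B) \<in> ?M"
    if "(f, B) \<in> chosen_cycles n (m + 1) P" for f B
  proof -
    have f: "f permutes {1..n}" and B: "B \<subseteq> cycles_of n f" "card B = m + 1"
      and P: "P (cycle_type n (codiag n f)) (merged_type n f (\<Union>B))"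
      using that by (auto simp: chosen_cycles_def)
    have fin: "finite B" using B finite_subset by fastforce
    define z where "z = Max (Min ` B)"
    have "B \<noteq> {}" using B by auto
    note top = top_cycle[OF f B(1) this, folded z_def]
    have eq: "insert (orbit f z) (B - {orbit f z}) = B" using top(1) by blast
    show "F (H (f, B)) = (f, B)" using eq by (simp add: F_def H_def z_def)
    have un: "\<Union>(B - {orbit f z}) \<union> orbit f z = \<Union>B" using top(1) by blast
    \<comment> \<open>The predecessor of a minimum lies in the same cycle and so is no
      smaller.\<close>
    have "z \<le> inv f z"
    proof -
      have "f (inv f z) = z" using permutes_inverses(1)[OF f] .
      then have "z \<in> orbit f (inv f z)" by (metis orbit.base)
      then have "inv f z \<in> orbit f z" using orbit_eq_orbit[OF f] orbit_self[OF f] by metis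
      then have "Min (orbit f z) \<le> inv f z" using orbit_Min(1)[OF f top(3)] by simp
      then show ?thesis using top(2) by simp
    qed
    moreover have "card (B - {orbit f z}) = m" using B(2) top(1) fin by simp
    moreover have "\<forall>X\<in>B - {orbit f z}. Min X < Min (orbit f z)" using top(2,4) by auto
    ultimately have "(f, B - {orbit f z}, z) \<in> marked n m P"
      using f B(1) P top(3) un unfolding marked_def by auto
    then show "H (f, B) \<in> ?M" using top(2) by (simp add: H_def z_def)
  qed
  have "bij_betw F ?M (chosen_cycles n (m + 1) P)"
  proof (rule bij_betw_byWitness[where f' = H])
    show "\<forall>x\<in>?M. H (F x) = x" using HF by force
    show "\<forall>x\<in>chosen_cycles n (m + 1) P. F (H x) = x" using FH by force
    show "F ` ?M \<subseteq> chosen_cycles n (m + 1) P" using F by force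
    show "H ` chosen_cycles n (m + 1) P \<subseteq> ?M" using H by force
  qed
  then show ?thesis by (rule bij_betw_same_card)
qed

text \<open>Cutting at the mark adds two cycles to \<open>A\<close> and leaves a mark in the third.
  Either that mark is non-trivial again, or it is the minimum and amounts to choosing the third
  cycle too.\<close>

lemma card_nontrivially_marked_rec:
  "card (nontrivially_marked n m P)
     = card (nontrivially_marked n (m + 2) P) + card (chosen_cycles n (m + 3) P)"
proof -
  let ?T = "{(f, A, z) \<in> marked n (m + 2) P. z = Min (orbit f z)}"
  have "card (nontrivially_marked n m P) = card (marked n (m + 2) P)"
    using card_merged_configs_eq_nontrivially_marked card_merged_configs_eq_split_configs card_split_configs_eq_marked by metis
  also have "marked n (m + 2) P = nontrivially_marked n (m + 2) P \<union> ?T"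
    by (auto simp: nontrivially_marked_def)
  also have "card \<dots> = card (nontrivially_marked n (m + 2) P) + card ?T"
  proof (rule card_Un_disjoint)
    show "finite (nontrivially_marked n (m + 2) P)" "finite ?T"
      by (rule finite_subset[OF _ finite_marked[of n "m + 2" P]], auto simp: nontrivially_marked_def)+
  qed (auto simp: nontrivially_marked_def)
  also have "card ?T = card (chosen_cycles n (m + 3) P)"
    using card_trivially_marked_eq_chosen_cycles[of n "m + 2" P] by (simp add: numeral_3_eq_3)
  finally show ?thesis .
qed

lemma card_cycles_of_le: "card (cycles_of n f) \<le> n"
  using card_image_le[of "{1..n}" "orbit f"] by (simp add: cycles_of_def)

text \<open>Each round of the recursion adds two cycles to \<open>A\<close>; it ends because there
  are at most \<open>n\<close> cycles.\<close>

lemma card_nontrivially_marked_sum: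
  "card (nontrivially_marked n 0 P) = (\<Sum>i\<in>{1..n}. card (chosen_cycles n (2 * i + 1) P))"
proof -
  have unroll: "card (nontrivially_marked n 0 P)
      = (\<Sum>i\<in>{1..t}. card (chosen_cycles n (2 * i + 1) P)) + card (nontrivially_marked n (2 * t) P)" for t
  proof (induction t)
    case (Suc t)
    have eq: "2 * t + 2 = 2 * Suc t" "2 * t + 3 = 2 * Suc t + 1" by simp_all
    show ?case using Suc card_nontrivially_marked_rec[of n "2 * t" P, unfolded eq] by simp
  qed simp
  \<comment> \<open>A mark in \<open>{1..n}\<close> forces \<open>n \<ge> 1\<close>, so
    \<open>2 * n\<close> exceeds the number of cycles.\<close>
  have "nontrivially_marked n (2 * n) P = {}"
  proof -
    have False if "(f, A, z) \<in> nontrivially_marked n (2 * n) P" for f A z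
    proof -
      have "A \<subseteq> cycles_of n f" "card A = 2 * n" "1 \<le> n"
        using that by (auto simp: nontrivially_marked_def marked_def)
      then show False using card_mono[of "cycles_of n f" A] card_cycles_of_le[of n f] by simp
    qed
    then show ?thesis by auto
  qed
  then show ?thesis unfolding unroll[of n] by simp
qed

section \<open>Counting\<close>

text \<open>\<open>kappa\<close> counts sets of positions in a sorted list. A bijection
  \<open>h\<close> from positions to elements of \<open>C\<close> that matches entries with
  cardinalities carries the count over to subsets of \<open>C\<close>.\<close>

lemma kappa_image_mset:
  fixes C :: "nat set set"
  assumes fin: "finite C"
  shows "kappa (image_mset card (mset_set C)) l = card {B. B \<subseteq> C \<and> card B + size l = card C + 1 \<and>
    add_mset (\<Sum>X\<in>B. card X) (image_mset card (mset_set (C - B))) = l}" (is "_ = card ?B")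
proof -
  let ?m = "image_mset card (mset_set C)"
  define xs where "xs = sorted_list_of_multiset ?m"
  have mxs: "mset xs = ?m" by (simp add: xs_def)
  obtain Cs where Cs: "set Cs = C" "distinct Cs" using finite_distinct_list[OF fin] by blast
  have "mset xs = mset (map card Cs)" using mxs Cs mset_set_set[of Cs] by simp
  then obtain p where p: "p permutes {..<length (map card Cs)}" "permute_list p (map card Cs) = xs"
    by (rule mset_eq_permutation)
  have len: "length xs = length Cs" using p(2) by (metis length_map length_permute_list)
  define h where "h i = Cs ! p i" for i
  have h: "bij_betw h {..<length xs} C"
  proof -
    have "bij_betw p {..<length xs} {..<length xs}" using permutes_imp_bij[OF p(1)] len by simp
    moreover have "bij_betw ((!) Cs) {..<length xs} C" by (rule bij_betw_nth) (use Cs len in auto)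
    ultimately have "bij_betw ((!) Cs \<circ> p) {..<length xs} C" by (rule bij_betw_trans)
    moreover have "(!) Cs \<circ> p = h" by (simp add: h_def fun_eq_iff)
    ultimately show ?thesis by simp
  qed
  have hx: "xs ! i = card (h i)" if "i < length xs" for i
  proof -
    have i: "i < length (map card Cs)" using that len by simp
    have "p i < length Cs" using permutes_in_image[OF p(1), of i] i by simp
    then show ?thesis using permute_list_nth[OF p(1) i] p(2) by (simp add: h_def)
  qed
  have size: "size ?m = card C" by simp
  let ?I = "{I. I \<subseteq> {..<length xs} \<and> card I + size l = size ?m + 1 \<and> merge_parts xs I = l}"
  have key: "merge_parts xs I = add_mset (\<Sum>X\<in>h ` I. card X) (image_mset card (mset_set (C - h ` I)))"
      "card (h ` I) = card I"
    if I: "I \<subseteq> {..<length xs}" for I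
  proof -
    have inj: "inj_on h {..<length xs}" and im: "h ` {..<length xs} = C" using h by (auto simp: bij_betw_def)
    have injI: "inj_on h I" and inj': "inj_on h ({..<length xs} - I)"
      using inj I by (auto intro: inj_on_subset)
    show "card (h ` I) = card I" using injI by (rule card_image)
    have "(\<Sum>X\<in>h ` I. card X) = (\<Sum>i\<in>I. xs ! i)"
      using I by (subst sum.reindex[OF injI]) (auto intro!: sum.cong simp: hx)
    moreover have "C - h ` I = h ` ({..<length xs} - I)"
      using inj_on_image_set_diff[OF inj, of "{..<length xs}" I] im I by simp
    moreover have "image_mset card (mset_set (h ` ({..<length xs} - I)))
        = image_mset (\<lambda>i. xs ! i) (mset_set ({..<length xs} - I))"
      by (simp flip: image_mset_mset_set[OF inj'] add: image_mset.compositionality)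
        (auto intro!: image_mset_cong simp: hx)
    ultimately show "merge_parts xs I
        = add_mset (\<Sum>X\<in>h ` I. card X) (image_mset card (mset_set (C - h ` I)))"
      by (simp add: merge_parts_def)
  qed
  have "bij_betw ((`) h) ?I ?B"
  proof (rule bij_betw_imageI)
    have P: "bij_betw ((`) h) (Pow {..<length xs}) (Pow C)" using h by (rule bij_betw_Pow)
    then show "inj_on ((`) h) ?I" by (rule inj_on_subset[OF bij_betw_imp_inj_on]) auto
    show "(`) h ` ?I = ?B"
    proof (intro equalityI subsetI)
      fix B assume "B \<in> (`) h ` ?I"
      then obtain I where "I \<in> ?I" "B = h ` I" by blast
      moreover from this have "h ` I \<in> Pow C" using P unfolding bij_betw_def by blast
      ultimately show "B \<in> ?B" using key[of I] size by simp
    next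
      fix B assume B: "B \<in> ?B"
      then have "B \<in> (`) h ` Pow {..<length xs}" using P unfolding bij_betw_def by blast
      then obtain I where "I \<subseteq> {..<length xs}" "B = h ` I" by blast
      moreover from this have "I \<in> ?I" using B key[of I] size by simp
      ultimately show "B \<in> (`) h ` ?I" by blast
    qed
  qed
  then have "card ?I = card ?B" by (rule bij_betw_same_card)
  then show ?thesis by (simp add: kappa_def Let_def flip: xs_def)
qed

lemma merged_type_Union:
  assumes f: "f permutes {1..n}" and B: "B \<subseteq> cycles_of n f"
  shows "merged_type n f (\<Union>B)
    = add_mset (\<Sum>X\<in>B. card X) (image_mset card (mset_set (cycles_of n f - B)))"
proof -
  have "card (\<Union>B) = (\<Sum>X\<in>B. card X)"
  proof (rule card_Union_disjoint)
    show "pairwise disjnt B" using cycles_of_disjoint[OF f] B by (auto simp: pairwise_def disjnt_def)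
    show "finite X" if "X \<in> B" for X using cycles_of_finite[OF f] B that by blast
  qed
  moreover have "{X \<in> cycles_of n f. X \<inter> \<Union>B = {}} = cycles_of n f - B"
    using cycles_of_disjoint[OF f] cycles_of_finite(2)[OF f] B by fastforce
  ultimately show ?thesis by (simp add: merged_type_def)
qed

lemma size_merged_type:
  assumes "f permutes {1..n}" "B \<subseteq> cycles_of n f"
  shows "size (merged_type n f (\<Union>B)) + card B = card (cycles_of n f) + 1"
proof -
  have "finite B" using assms(2) finite_subset by fastforce
  then show ?thesis using merged_type_Union[OF assms] card_Diff_subset[of B "cycles_of n f"] assms(2)
      card_mono[of "cycles_of n f" B] by simp
qed

lemma size_cycle_type: "size (cycle_type n f) = card (cycles_of n f)"
  by (simp add: cycle_type_def)

text \<open>Merging a single cycle changes nothing, so without accompanying cycles the condition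
  \<open>P\<close> sees plain cycle types.\<close>

lemma merged_type_orbit:
  assumes f: "f permutes {1..n}" and "z \<in> {1..n}"
  shows "merged_type n f (orbit f z) = cycle_type n f"
proof -
  have c: "orbit f z \<in> cycles_of n f" using assms by (auto simp: cycles_of_def)
  then have "mset_set (cycles_of n f) = add_mset (orbit f z) (mset_set (cycles_of n f - {orbit f z}))"
    by (intro mset_set.remove) auto
  then show ?thesis using merged_type_Union[OF f, of "{orbit f z}"] c by (simp add: cycle_type_def)
qed

lemma cycle_type_in_partitions:
  assumes f: "f permutes {1..n}"
  shows "cycle_type n f \<in> number_partitions n"
proof -
  have "\<Union>(cycles_of n f) = {1..n}"
    using cycles_of_subset[OF f] orbit_self[OF f] by (fastforce simp: cycles_of_def)
  moreover have "card (\<Union>(cycles_of n f)) = (\<Sum>X\<in>cycles_of n f. card X)"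
  proof (rule card_Union_disjoint)
    show "pairwise disjnt (cycles_of n f)"
      using cycles_of_disjoint[OF f] by (auto simp: pairwise_def disjnt_def)
  qed (use cycles_of_finite[OF f] in blast)
  moreover have "0 \<notin># cycle_type n f"
    using cycles_of_finite[OF f] by (fastforce simp: cycle_type_def card_eq_0_iff)
  ultimately show ?thesis
    by (simp add: number_partitions_def cycle_type_def sum_unfold_sum_mset)
qed

section \<open>Counting anti-exceedances\<close>

definition anti_exceedances :: "nat \<Rightarrow> (nat \<Rightarrow> nat) \<Rightarrow> nat set" where
  "anti_exceedances n f = {z \<in> {1..n}. z \<le> inv f z}"

definition nontrivial_anti_exceedances :: "nat \<Rightarrow> (nat \<Rightarrow> nat) \<Rightarrow> nat set" where
  "nontrivial_anti_exceedances n f = {z \<in> anti_exceedances n f. z \<noteq> Min (orbit f z)}"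

text \<open>A point \<open>x < n\<close> satisfies exactly one of \<open>f x \<le> x\<close> and \<open>rot n x = x + 1 \<le> f x\<close>, while \<open>x = n\<close>
  satisfies both.\<close>

lemma card_anti_exceedances_codiag:
  assumes n: "n \<ge> 1" and f: "f permutes {1..n}"
  shows "card (anti_exceedances n f) + card (anti_exceedances n (codiag n f)) = n + 1"
proof -
  have r: "rot n permutes {1..n}" using n by (rule rot_permutes)
  have inv: "inv (codiag n f) (rot n x) = f x" for x
  proof -
    have "codiag n f (f x) = rot n x" using permutes_inverses(2)[OF f] by (simp add: codiag_def)
    then show ?thesis using permutes_inverses(2)[OF codiag_permutes[OF n f]] by metis
  qed
  \<comment> \<open>Both sets of anti-exceedances are indexed by their common predecessor data:
    \<open>x\<close> stands for \<open>f x\<close> in the first and for \<open>rot n x\<close>,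
    whose predecessor under the diagonal is \<open>f x\<close>, in the second.\<close>
  let ?X = "{x \<in> {1..n}. f x \<le> x}" and ?Y = "{x \<in> {1..n}. rot n x \<le> f x}"
  have "anti_exceedances n f = f ` ?X"
  proof
    show "anti_exceedances n f \<subseteq> f ` ?X"
    proof
      fix z assume z: "z \<in> anti_exceedances n f"
      then have "inv f z \<in> ?X"
        using permutes_in_image[OF permutes_inv[OF f], of z] permutes_inverses(1)[OF f]
        by (simp add: anti_exceedances_def)
      then show "z \<in> f ` ?X" using permutes_inverses(1)[OF f] by (metis image_eqI)
    qed
    show "f ` ?X \<subseteq> anti_exceedances n f"
      using permutes_in_image[OF f] permutes_inverses(2)[OF f] by (auto simp: anti_exceedances_def)
  qed
  then have 1: "card (anti_exceedances n f) = card ?X"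
    using card_image[OF inj_on_subset[OF permutes_inj[OF f]]] by simp
  have "anti_exceedances n (codiag n f) = rot n ` ?Y"
  proof
    show "anti_exceedances n (codiag n f) \<subseteq> rot n ` ?Y"
    proof
      fix z assume z: "z \<in> anti_exceedances n (codiag n f)"
      define x where "x = inv (rot n) z"
      have zx: "z = rot n x" using permutes_inverses(1)[OF r] by (simp add: x_def)
      then have "x \<in> ?Y" using z inv permutes_in_image[OF r, of x] by (simp add: anti_exceedances_def)
      then show "z \<in> rot n ` ?Y" using zx by blast
    qed
    show "rot n ` ?Y \<subseteq> anti_exceedances n (codiag n f)"
      using permutes_in_image[OF r] inv by (auto simp: anti_exceedances_def)
  qed
  then have 2: "card (anti_exceedances n (codiag n f)) = card ?Y"
    using card_image[OF inj_on_subset[OF permutes_inj[OF r]]] by simp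
  have fn: "f x \<in> {1..n}" if "x \<in> {1..n}" for x using permutes_in_image[OF f] that by blast
  have "?X \<union> ?Y = {1..n}"
  proof -
    have "rot n x \<le> f x" if "x \<in> {1..n}" "\<not> f x \<le> x" for x
      using fn[OF that(1)] that by (auto simp: rot_def)
    then show ?thesis by blast
  qed
  moreover have "?X \<inter> ?Y = {n}"
  proof -
    have "x = n" if "x \<in> {1..n}" "f x \<le> x" "rot n x \<le> f x" for x
      using that by (auto simp: rot_def split: if_splits)
    moreover have "f n \<le> n" "rot n n \<le> f n" using fn[of n] n by (auto simp: rot_def)
    ultimately show ?thesis using n by auto
  qed
  moreover have "card ?X + card ?Y = card (?X \<union> ?Y) + card (?X \<inter> ?Y)"
    by (rule card_Un_Int) auto
  ultimately show ?thesis using 1 2 by simp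
qed

lemma card_nontrivial_anti_exceedances:
  assumes f: "f permutes {1..n}"
  shows "card (anti_exceedances n f) = card (nontrivial_anti_exceedances n f) + card (cycles_of n f)"
proof -
  let ?M = "{z \<in> {1..n}. z = Min (orbit f z)}"
  have le: "z \<le> inv f z" if "z \<in> ?M" for z
  proof -
    have z: "z \<in> {1..n}" "Min (orbit f z) = z" using that by auto
    have "z \<in> orbit f (inv f z)" using permutes_inverses(1)[OF f] by (metis orbit.base)
    then have "inv f z \<in> orbit f z" using orbit_eq_orbit[OF f] orbit_self[OF f] by metis
    then have "Min (orbit f z) \<le> inv f z" using orbit_Min(1)[OF f z(1)] by simp
    then show ?thesis using z(2) by simp
  qed
  have "bij_betw Min (cycles_of n f) ?M"
  proof (rule bij_betw_byWitness[where f' = "orbit f"])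
    show "\<forall>X\<in>cycles_of n f. orbit f (Min X) = X" using orbit_Min[OF f] by (auto simp: cycles_of_def)
    show "Min ` cycles_of n f \<subseteq> ?M" using orbit_Min[OF f] by (auto simp: cycles_of_def)
  qed (auto simp: cycles_of_def)
  then have M: "card (cycles_of n f) = card ?M" by (rule bij_betw_same_card)
  have "anti_exceedances n f = nontrivial_anti_exceedances n f \<union> ?M"
    using le by (auto simp: anti_exceedances_def nontrivial_anti_exceedances_def)
  moreover have "card (nontrivial_anti_exceedances n f \<union> ?M)
      = card (nontrivial_anti_exceedances n f) + card ?M"
    by (rule card_Un_disjoint) (auto simp: anti_exceedances_def nontrivial_anti_exceedances_def)
  ultimately show ?thesis using M by simp
qed

lemma card_nontrivially_marked_0:
  "card (nontrivially_marked n 0 P) = (\<Sum>f | f permutes {1..n} \<and>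
     P (cycle_type n (codiag n f)) (cycle_type n f). card (nontrivial_anti_exceedances n f))"
proof -
  let ?S = "{f. f permutes {1..n} \<and> P (cycle_type n (codiag n f)) (cycle_type n f)}"
  let ?F = "\<lambda>(f, z). (f, {} :: nat set set, z)"
  have eq: "nontrivially_marked n 0 P = ?F ` (SIGMA f:?S. nontrivial_anti_exceedances n f)"
  proof (intro equalityI subsetI)
    fix x assume "x \<in> nontrivially_marked n 0 P"
    then obtain f A z where x: "x = (f, A, z)" and m: "(f, A, z) \<in> marked n 0 P" "z \<noteq> Min (orbit f z)"
      by (auto simp: nontrivially_marked_def)
    have f: "f permutes {1..n}" "z \<in> {1..n}" and "A = {}"
      using m(1) finite_subset[OF _ finite_cycles_of, of A n f] by (auto simp: marked_def)
    then have "(f, z) \<in> (SIGMA f:?S. nontrivial_anti_exceedances n f)"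
      using m merged_type_orbit[OF f]
      by (simp add: marked_def nontrivial_anti_exceedances_def anti_exceedances_def)
    then show "x \<in> ?F ` (SIGMA f:?S. nontrivial_anti_exceedances n f)"
      using x \<open>A = {}\<close> by (intro image_eqI[of _ _ "(f, z)"]) auto
  next
    fix x assume "x \<in> ?F ` (SIGMA f:?S. nontrivial_anti_exceedances n f)"
    then obtain f z where x: "x = (f, {}, z)" and fz: "f \<in> ?S" "z \<in> nontrivial_anti_exceedances n f"
      by auto
    then show "x \<in> nontrivially_marked n 0 P"
      using merged_type_orbit[of f n z]
      by (simp add: nontrivially_marked_def marked_def nontrivial_anti_exceedances_def
          anti_exceedances_def)
  qed
  have "inj_on ?F (SIGMA f:?S. nontrivial_anti_exceedances n f)" by (auto simp: inj_on_def)
  then have "card (nontrivially_marked n 0 P)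
      = card (SIGMA f:?S. nontrivial_anti_exceedances n f)" unfolding eq by (rule card_image)
  also have "\<dots> = (\<Sum>f\<in>?S. card (nontrivial_anti_exceedances n f))"
  proof (rule card_SigmaI)
    show "finite ?S" by (rule finite_subset[OF _ finite_permutations[of "{1..n}"]]) auto
    show "\<forall>f\<in>?S. finite (nontrivial_anti_exceedances n f)"
      by (simp add: nontrivial_anti_exceedances_def anti_exceedances_def)
  qed
  finally show ?thesis .
qed

section \<open>Exchanging a permutation with its diagonal\<close>

text \<open>Here the long cycle is fixed to \<open>rot n\<close> and only the type of the diagonal
  is prescribed, whereas \<open>diagonal_count\<close> fixes the diagonal and lets the long cycle
  vary.\<close>

definition typed_perms :: "nat \<Rightarrow> nat \<Rightarrow> nat multiset \<Rightarrow> (nat \<Rightarrow> nat) set" where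
  "typed_perms n k l =
     {f. f permutes {1..n} \<and> cycle_type n (codiag n f) = l \<and> card (cycles_of n f) = k}"

lemma finite_typed_perms: "finite (typed_perms n k l)"
  by (rule finite_subset[OF _ finite_permutations[of "{1..n}"]]) (auto simp: typed_perms_def)

lemma inj_on_codiag:
  assumes "n \<ge> 1"
  shows "inj_on (codiag n) {f. f permutes {1..n}}"
proof (rule inj_onI)
  fix f g assume fg: "f \<in> {f. f permutes {1..n}}" "g \<in> {f. f permutes {1..n}}" "codiag n f = codiag n g"
  have "rot n (inv f x) = rot n (inv g x)" for x
    using fg(3) by (metis codiag_def comp_apply)
  then have "inv f = inv g" using permutes_inj[OF rot_permutes[OF assms]] by (auto simp: inj_eq)
  then show "f = g" using fg(1,2) permutes_inv_inv by (metis mem_Collect_eq)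
qed

text \<open>Up to conjugation by the long cycle \<open>codiag n\<close> is an involution, which lets
  \<open>f\<close> and its diagonal exchange roles.\<close>

lemma codiag_codiag:
  assumes n: "n \<ge> 1" and f: "f permutes {1..n}"
  shows "codiag n (codiag n f) = rot n \<circ> f \<circ> inv (rot n)"
proof -
  have r: "rot n permutes {1..n}" using n by (rule rot_permutes)
  have "inv (codiag n f) = f \<circ> inv (rot n)"
    unfolding codiag_def using permutes_inv_o[OF r] permutes_inv_o[OF f]
    by (intro inv_unique_comp) (simp_all add: fun_eq_iff)
  then show ?thesis by (simp add: codiag_def[of n "codiag n f"] comp_assoc)
qed

lemma image_codiag_typed_perms:
  assumes n: "n \<ge> 1"
  shows "codiag n ` typed_perms n k l =
    {f. f permutes {1..n} \<and> cycle_type n f = l \<and> card (cycles_of n (codiag n f)) = k}"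
proof -
  have r: "rot n permutes {1..n}" using n by (rule rot_permutes)
  have cyc: "card (cycles_of n (codiag n (codiag n f))) = card (cycles_of n f)"
    if "f permutes {1..n}" for f
    unfolding codiag_codiag[OF n that] by (rule card_cycles_of_conj[OF r])
  have surj: "codiag n ` {f. f permutes {1..n}} = {f. f permutes {1..n}}"
    using codiag_permutes[OF n] by (intro endo_inj_surj finite_permutations inj_on_codiag[OF n]) auto
  show ?thesis
  proof (intro equalityI subsetI)
    fix g assume "g \<in> codiag n ` typed_perms n k l"
    then show "g \<in> {f. f permutes {1..n} \<and> cycle_type n f = l \<and> card (cycles_of n (codiag n f)) = k}"
      using codiag_permutes[OF n] cyc by (auto simp: typed_perms_def)
  next
    fix g assume g: "g \<in> {f. f permutes {1..n} \<and> cycle_type n f = l \<and> card (cycles_of n (codiag n f)) = k}"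
    then have "g \<in> codiag n ` {f. f permutes {1..n}}" unfolding surj by simp
    then obtain f where "f permutes {1..n}" "g = codiag n f" by blast
    then show "g \<in> codiag n ` typed_perms n k l" using g cyc by (auto simp: typed_perms_def)
  qed
qed

lemma inj_on_codiag_typed_perms: "n \<ge> 1 \<Longrightarrow> inj_on (codiag n) (typed_perms n k l)"
  by (rule inj_on_subset[OF inj_on_codiag]) (auto simp: typed_perms_def)

lemma card_typed_perms_swap:
  assumes "n \<ge> 1"
  shows "card {f. f permutes {1..n} \<and> cycle_type n f = l \<and> card (cycles_of n (codiag n f)) = k}
    = card (typed_perms n k l)"
  unfolding image_codiag_typed_perms[OF assms, symmetric]
  by (rule card_image[OF inj_on_codiag_typed_perms[OF assms]])

section \<open>Evaluating the two sums\<close>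

text \<open>Merging \<open>2 * i + 1\<close> cycles into one lowers the number of cycles by
  \<open>2 * i\<close>, so \<open>f\<close> has \<open>k + 2 * i\<close> of them. Choosing
  \<open>2 * i + 1\<close> of these means leaving out \<open>k - 1\<close>.\<close>

lemma card_chosen_cycles_codiag_type:
  assumes "k \<ge> 1"
  shows "card (chosen_cycles n (2 * i + 1) (\<lambda>\<alpha> \<beta>. \<alpha> = l \<and> size \<beta> = k))
    = ((k + 2 * i) choose (k - 1)) * card (typed_perms n (k + 2 * i) l)"
proof -
  let ?S = "\<lambda>f. {B. B \<subseteq> cycles_of n f \<and> card B = 2 * i + 1}"
  have "chosen_cycles n (2 * i + 1) (\<lambda>\<alpha> \<beta>. \<alpha> = l \<and> size \<beta> = k) = (SIGMA f:typed_perms n (k + 2 * i) l. ?S f)"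
  proof -
    have "size (merged_type n f (\<Union>B)) = k \<longleftrightarrow> card (cycles_of n f) = k + 2 * i"
      if "f permutes {1..n}" "B \<subseteq> cycles_of n f" "card B = 2 * i + 1" for f B
      using size_merged_type[OF that(1,2)] that(3) by auto
    then show ?thesis by (auto simp: chosen_cycles_def typed_perms_def)
  qed
  also have "card \<dots> = (\<Sum>f\<in>typed_perms n (k + 2 * i) l. card (?S f))"
    by (rule card_SigmaI[OF finite_typed_perms]) auto
  also have "\<dots> = (\<Sum>f\<in>typed_perms n (k + 2 * i) l. (k + 2 * i) choose (k - 1))"
  proof (rule sum.cong[OF refl])
    fix f assume "f \<in> typed_perms n (k + 2 * i) l"
    then have "card (cycles_of n f) = k + 2 * i" by (simp add: typed_perms_def)
    moreover have "(k + 2 * i) choose (2 * i + 1) = (k + 2 * i) choose (k - 1)"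
      using assms binomial_symmetric[of "2 * i + 1" "k + 2 * i"] by simp
    ultimately show "card (?S f) = (k + 2 * i) choose (k - 1)"
      using n_subsets[of "cycles_of n f" "2 * i + 1"] by simp
  qed
  finally show ?thesis by simp
qed

text \<open>Choosing \<open>j\<close> cycles whose merging gives \<open>l\<close> exhibits the cycle
  type as \<open>l\<close> with one part split into \<open>j\<close>. Conversely, given such a
  split, the size condition in \<open>kappa\<close> says that exactly \<open>j\<close> cycles are
  chosen.\<close>

lemma card_cycle_subsets_kappa:
  assumes f: "f permutes {1..n}"
  shows "card {B. B \<subseteq> cycles_of n f \<and> card B = j \<and> merged_type n f (\<Union>B) = l}
    = (if splits_part j (cycle_type n f) l then kappa (cycle_type n f) l else 0)"
    (is "card ?S = _")
proof -
  let ?C = "cycles_of n f"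
  have fin: "finite B" if "B \<subseteq> ?C" for B using that finite_subset finite_cycles_of by blast
  have split: "splits_part j (cycle_type n f) l" if B: "B \<in> ?S" for B
  proof -
    have "image_mset card (mset_set ?C) = image_mset card (mset_set (?C - B)) + image_mset card (mset_set B)"
      using B fin[of B] mset_set_Union[of "?C - B" B]
      by (simp add: Un_absorb2 Diff_disjoint Int_commute flip: image_mset_union)
    moreover have "l = add_mset (\<Sum>X\<in>B. card X) (image_mset card (mset_set (?C - B)))"
      using B merged_type_Union[OF f, of B] by simp
    moreover have "0 \<notin># image_mset card (mset_set B)"
    proof -
      have "card X \<noteq> 0" if "X \<in> B" for X
        using cycles_of_finite[OF f, of X] B that by (auto simp: card_gt_0_iff)
      then have "0 \<notin> card ` B" by (metis imageE)
      then show ?thesis using B fin[of B] by simp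
    qed
    moreover have "size (image_mset card (mset_set B)) = j" using B by simp
    moreover have "sum_mset (image_mset card (mset_set B)) = (\<Sum>X\<in>B. card X)"
      by (simp add: sum_unfold_sum_mset)
    ultimately show ?thesis unfolding splits_part_def cycle_type_def
      by (intro exI[of _ "\<Sum>X\<in>B. card X"] exI[of _ "image_mset card (mset_set B)"]) simp
  qed
  show ?thesis
  proof (cases "splits_part j (cycle_type n f) l")
    case True
    then obtain a v where av: "a \<in># l" "size v = j" "cycle_type n f = (l - {#a#}) + v"
      by (auto simp: splits_part_def)
    have "size l = Suc (size (l - {#a#}))" using av(1) by (metis insert_DiffM size_add_mset)
    moreover have "size (cycle_type n f) = size (l - {#a#}) + j" by (simp only: av size_union)
    ultimately have "size l + j = card ?C + 1" by (simp add: size_cycle_type)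
    then have "?S = {B. B \<subseteq> ?C \<and> card B + size l = card ?C + 1 \<and>
        add_mset (\<Sum>X\<in>B. card X) (image_mset card (mset_set (?C - B))) = l}"
      using merged_type_Union[OF f] by (intro Collect_cong) auto
    then show ?thesis
      using True kappa_image_mset[OF finite_cycles_of, of n f l] by (simp add: cycle_type_def)
  next
    case False
    then have "?S = {}" using split by blast
    then show ?thesis using False by simp
  qed
qed

text \<open>The pairs are grouped by the cycle type \<open>m\<close> of \<open>f\<close>:
  \<open>kappa m l\<close> counts the choices for each \<open>f\<close>, and
  \<open>card_typed_perms_swap\<close> counts the \<open>f\<close>.\<close>

lemma card_chosen_cycles_merged_type:
  assumes n: "n \<ge> 1"
  shows "card (chosen_cycles n j (\<lambda>\<alpha> \<beta>. \<beta> = l \<and> size \<alpha> = k))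
    = (\<Sum>m | m \<in> number_partitions n \<and> splits_part j m l. kappa m l * card (typed_perms n k m))"
proof -
  let ?T = "{f. f permutes {1..n} \<and> card (cycles_of n (codiag n f)) = k}"
  let ?S = "\<lambda>f. {B. B \<subseteq> cycles_of n f \<and> card B = j \<and> merged_type n f (\<Union>B) = l}"
  let ?M = "{m. m \<in> number_partitions n \<and> splits_part j m l}"
  have finT: "finite ?T" by (rule finite_subset[OF _ finite_permutations[of "{1..n}"]]) auto
  have finS: "finite (?S f)" for f by (rule finite_subset[of _ "Pow (cycles_of n f)"]) auto
  have finM: "finite ?M" using finite_number_partitions[of n] by simp
  have chosen: "chosen_cycles n j (\<lambda>\<alpha> \<beta>. \<beta> = l \<and> size \<alpha> = k) = (SIGMA f:?T. ?S f)"
    by (auto simp: chosen_cycles_def size_cycle_type)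
  have kappa: "card (?S f) = (if splits_part j (cycle_type n f) l then kappa (cycle_type n f) l else 0)"
    if "f \<in> ?T" for f
    by (rule card_cycle_subsets_kappa) (use that in simp)
  have "card (SIGMA f:?T. ?S f) = (\<Sum>f\<in>?T. card (?S f))"
    using finS by (intro card_SigmaI[OF finT] ballI)
  also have "\<dots> = (\<Sum>f\<in>?T. if splits_part j (cycle_type n f) l then kappa (cycle_type n f) l else 0)"
    using kappa by (rule sum.cong[OF refl])
  also have "\<dots> = (\<Sum>f\<in>{f \<in> ?T. splits_part j (cycle_type n f) l}. kappa (cycle_type n f) l)"
    by (rule sum.inter_filter[symmetric, OF finT])
  also have "\<dots> = (\<Sum>m\<in>?M. \<Sum>f\<in>{f \<in> {f \<in> ?T. splits_part j (cycle_type n f) l}. cycle_type n f = m}.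
      kappa (cycle_type n f) l)"
  proof (rule sum.group[symmetric])
    show "finite {f \<in> ?T. splits_part j (cycle_type n f) l}" using finT by (rule finite_subset[rotated]) blast
    show "cycle_type n ` {f \<in> ?T. splits_part j (cycle_type n f) l} \<subseteq> ?M"
      using cycle_type_in_partitions by blast
  qed (rule finM)
  also have "\<dots> = (\<Sum>m\<in>?M. kappa m l * card (typed_perms n k m))"
  proof (rule sum.cong[OF refl])
    fix m assume m: "m \<in> ?M"
    then have eq: "{f \<in> {f \<in> ?T. splits_part j (cycle_type n f) l}. cycle_type n f = m}
        = {f. f permutes {1..n} \<and> cycle_type n f = m \<and> card (cycles_of n (codiag n f)) = k}" by auto
    have "(\<Sum>f\<in>{f. f permutes {1..n} \<and> cycle_type n f = m \<and> card (cycles_of n (codiag n f)) = k}.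
        kappa (cycle_type n f) l) = kappa m l * card (typed_perms n k m)"
      using card_typed_perms_swap[OF n, of m k] by simp
    then show "(\<Sum>f\<in>{f \<in> {f \<in> ?T. splits_part j (cycle_type n f) l}. cycle_type n f = m}.
        kappa (cycle_type n f) l) = kappa m l * card (typed_perms n k m)" unfolding eq .
  qed
  finally show ?thesis unfolding chosen .
qed

text \<open>The non-trivial anti-exceedances of \<open>f\<close> and of its diagonal are counted
  over \<open>typed_perms n k l\<close>, where each \<open>f\<close> contributes
  \<open>n + 1 - k - size l\<close>. The subtracted terms stand on the left because subtraction on
  \<open>nat\<close> truncates.\<close>

lemma typed_perms_recurrence:
  assumes n: "n \<ge> 1" and k: "k \<ge> 1"
  shows "(\<Sum>i\<in>{1..n}. ((k + 2 * i) choose (k - 1)) * card (typed_perms n (k + 2 * i) l))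
     + (\<Sum>i\<in>{1..n}. \<Sum>m | m \<in> number_partitions n \<and> splits_part (2 * i + 1) m l.
          kappa m l * card (typed_perms n k m))
     + (k + size l) * card (typed_perms n k l) = (n + 1) * card (typed_perms n k l)"
proof -
  let ?S = "typed_perms n k l" and ?nt = "\<lambda>f. card (nontrivial_anti_exceedances n f)"
  \<comment> \<open>\<open>?P1\<close> puts the marks in the members of \<open>?S\<close>. With
    \<open>?P2\<close> the marked permutation is the diagonal of such a member.\<close>
  let ?P1 = "\<lambda>\<alpha> \<beta>. \<alpha> = l \<and> size \<beta> = k" and ?P2 = "\<lambda>\<alpha> \<beta>. \<beta> = l \<and> size \<alpha> = k"
  have "{f. f permutes {1..n} \<and> ?P1 (cycle_type n (codiag n f)) (cycle_type n f)} = ?S"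
    by (auto simp: typed_perms_def size_cycle_type)
  then have 1: "card (nontrivially_marked n 0 ?P1) = (\<Sum>f\<in>?S. ?nt f)"
    using card_nontrivially_marked_0[of n ?P1] by simp
  have "{f. f permutes {1..n} \<and> ?P2 (cycle_type n (codiag n f)) (cycle_type n f)} = codiag n ` ?S"
    unfolding image_codiag_typed_perms[OF n] by (auto simp: size_cycle_type)
  then have "card (nontrivially_marked n 0 ?P2) = (\<Sum>f\<in>codiag n ` ?S. ?nt f)"
    using card_nontrivially_marked_0[of n ?P2] by simp
  also have "\<dots> = (\<Sum>f\<in>?S. ?nt (codiag n f))"
    by (simp add: sum.reindex[OF inj_on_codiag_typed_perms[OF n]])
  finally have 2: "card (nontrivially_marked n 0 ?P2) = (\<Sum>f\<in>?S. ?nt (codiag n f))" .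
  have "?nt f + ?nt (codiag n f) + (k + size l) = n + 1" if "f \<in> ?S" for f
  proof -
    have f: "f permutes {1..n}" and "card (cycles_of n f) = k"
      "card (cycles_of n (codiag n f)) = size l"
      using that size_cycle_type[of n "codiag n f"] by (auto simp: typed_perms_def)
    then show ?thesis
      using card_anti_exceedances_codiag[OF n f] card_nontrivial_anti_exceedances[OF f]
        card_nontrivial_anti_exceedances[OF codiag_permutes[OF n f]] by simp
  qed
  then have "(\<Sum>f\<in>?S. ?nt f + ?nt (codiag n f) + (k + size l)) = (n + 1) * card ?S"
    by (simp add: mult.commute)
  then have "card (nontrivially_marked n 0 ?P1) + card (nontrivially_marked n 0 ?P2)
      + (k + size l) * card ?S = (n + 1) * card ?S"
    unfolding 1 2 by (simp add: sum.distrib mult.commute)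
  then show ?thesis
    unfolding card_nontrivially_marked_sum card_chosen_cycles_codiag_type[OF k]
      card_chosen_cycles_merged_type[OF n] .
qed

section \<open>From the fixed long cycle to a fixed diagonal\<close>

lemma cyclic_on_rot:
  assumes n: "n \<ge> 1"
  shows "cyclic_on (rot n) {1..n}"
proof -
  have pow: "(rot n ^^ i) 1 = Suc i" if "i < n" for i
    using that by (induction i) (auto simp: rot_def)
  have r: "rot n permutes {1..n}" using n by (rule rot_permutes)
  have "x \<in> orbit (rot n) 1" if "x \<in> {1..n}" for x
  proof -
    have "x - 1 < n" "Suc (x - 1) = x" using that by auto
    then have "x = (rot n ^^ (x - 1)) 1" using pow by metis
    then show ?thesis using in_orbit_iff_funpow[OF r] by blast
  qed
  moreover have "orbit (rot n) 1 \<subseteq> {1..n}" using permutes_orbit_subset[OF r] n by simp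
  ultimately have "{1..n} = orbit (rot n) 1" by blast
  moreover have "1 \<in> {1..n}" using n by simp
  ultimately show ?thesis unfolding cyclic_on_def by (rule bexI)
qed

text \<open>Sharing this type makes all long cycles conjugate to \<open>rot n\<close>, by
  \<open>exists_conjugator\<close>.\<close>

lemma cyclic_on_perms_of_type:
  assumes "n \<ge> 1" "s permutes {1..n}" "cyclic_on s {1..n}"
  shows "s \<in> perms_of_type n {#n#}"
proof -
  have "cycles_of n s = (\<lambda>_. {1..n}) ` {1..n}"
    unfolding cycles_of_def using orbit_cyclic_eq3[OF assms(3)] by (intro image_cong) auto
  then have "cycles_of n s = {{1..n}}" using assms(1) by auto
  then show ?thesis using assms(2) by (simp add: perms_of_type_def cycle_type_def)
qed

text \<open>Conjugation by \<sigma> maps the permutations counted for \<open>D\<close> injectively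
  to ones counted for \<open>E\<close>. Equality follows later by exchanging \<open>D\<close> and
  \<open>E\<close>.\<close>

lemma card_typed_perms_conj_le:
  assumes \<sigma>: "\<sigma> permutes {1..n}" and E: "E = \<sigma> \<circ> D \<circ> inv \<sigma>"
  shows "card {p. p permutes {1..n} \<and> cycle_type n (D \<circ> inv p) = l \<and> card (cycles_of n p) = k}
    \<le> card {p. p permutes {1..n} \<and> cycle_type n (E \<circ> inv p) = l \<and> card (cycles_of n p) = k}"
proof (rule card_inj_on_le)
  let ?c = "\<lambda>p. \<sigma> \<circ> p \<circ> inv \<sigma>"
  have isig: "inv \<sigma> permutes {1..n}" using \<sigma> by (rule permutes_inv)
  show "inj_on ?c {p. p permutes {1..n} \<and> cycle_type n (D \<circ> inv p) = l \<and> card (cycles_of n p) = k}"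
  proof (rule inj_onI)
    fix f g assume "?c f = ?c g"
    then have "\<sigma> (f x) = \<sigma> (g x)" for x using permutes_inverses(2)[OF \<sigma>] by (metis comp_apply)
    then show "f = g" using permutes_inj[OF \<sigma>] by (auto simp: inj_eq)
  qed
  show "finite {p. p permutes {1..n} \<and> cycle_type n (E \<circ> inv p) = l \<and> card (cycles_of n p) = k}"
    by (rule finite_subset[OF _ finite_permutations[of "{1..n}"]]) auto
  show "?c ` {p. p permutes {1..n} \<and> cycle_type n (D \<circ> inv p) = l \<and> card (cycles_of n p) = k}
    \<subseteq> {p. p permutes {1..n} \<and> cycle_type n (E \<circ> inv p) = l \<and> card (cycles_of n p) = k}"
  proof (rule image_subsetI)
    fix p assume "p \<in> {p. p permutes {1..n} \<and> cycle_type n (D \<circ> inv p) = l \<and> card (cycles_of n p) = k}"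
    then have p: "p permutes {1..n}" "cycle_type n (D \<circ> inv p) = l" "card (cycles_of n p) = k" by auto
    have "inv (?c p) = ?c (inv p)"
      using permutes_inv_o[OF \<sigma>] permutes_inv_o[OF p(1)]
      by (intro inv_unique_comp) (simp_all add: fun_eq_iff)
    then have "E \<circ> inv (?c p) = ?c (D \<circ> inv p)"
      using permutes_inv_o[OF \<sigma>] E by (simp add: fun_eq_iff)
    then have "cycle_type n (E \<circ> inv (?c p)) = l" using cycle_type_conj[OF \<sigma>] p(2) by simp
    moreover have "?c p permutes {1..n}"
      by (rule permutes_compose[OF isig permutes_compose[OF p(1) \<sigma>]])
    moreover have "card (cycles_of n (?c p)) = k" using card_cycles_of_conj[OF \<sigma>] p(3) by simp
    ultimately show "?c p \<in> {p. p permutes {1..n} \<and> cycle_type n (E \<circ> inv p) = l \<and> card (cycles_of n p) = k}"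
      by simp
  qed
qed

text \<open>Double counting of the plane permutations \<open>(s, p)\<close> with diagonal of type
  \<open>l\<close> and \<open>k\<close> cycles in \<open>p\<close>: every diagonal contributes
  \<open>plane_count n k l\<close>, and every long cycle, being conjugate to \<open>rot n\<close>,
  contributes \<open>card (typed_perms n k l)\<close>.\<close>

lemma plane_count_typed_perms:
  assumes n: "n \<ge> 1"
  shows "plane_count n k l * cycle_type_count n l
    = card {s. s permutes {1..n} \<and> cyclic_on s {1..n}} * card (typed_perms n k l)"
proof -
  let ?S = "{s. s permutes {1..n} \<and> cyclic_on s {1..n}}"
  let ?Q = "\<lambda>s. {p. p permutes {1..n} \<and> cycle_type n (s \<circ> inv p) = l \<and> card (cycles_of n p) = k}"
  let ?R = "\<lambda>D. {P \<in> plane_permutations n. diagonal P = D \<and> card (cycles_of n (snd P)) = k}"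
  have fin: "finite {f. f permutes {1..n} \<and> Q f}" for Q
    by (rule finite_subset[OF _ finite_permutations[of "{1..n}"]]) auto
  have finP: "finite (plane_permutations n)"
    by (rule finite_subset[of _ "{p. p permutes {1..n}} \<times> {p. p permutes {1..n}}"])
      (auto simp: plane_permutations_def intro!: finite_permutations)
  have finl: "finite (perms_of_type n l)" using fin by (simp add: perms_of_type_def)
  have le: "card (?Q D) \<le> card (?Q E)"
    if DE: "D \<in> perms_of_type n {#n#}" "E \<in> perms_of_type n {#n#}" for D E
  proof -
    obtain \<sigma> where \<sigma>: "\<sigma> permutes {1..n}" "E = \<sigma> \<circ> D \<circ> inv \<sigma>"
      using exists_conjugator[OF DE] by blast
    then show ?thesis by (rule card_typed_perms_conj_le)
  qed
  have Q: "card (?Q s) = card (typed_perms n k l)" if s: "s \<in> ?S" for s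
  proof -
    have "s \<in> perms_of_type n {#n#}" using cyclic_on_perms_of_type[OF n] s by simp
    moreover have "rot n \<in> perms_of_type n {#n#}"
      using cyclic_on_perms_of_type[OF n rot_permutes[OF n] cyclic_on_rot[OF n]] .
    ultimately have "card (?Q s) = card (?Q (rot n))"
      using le by (intro order_antisym)
    then show ?thesis by (simp add: typed_perms_def codiag_def)
  qed
  have "(\<Union>D\<in>perms_of_type n l. ?R D) = (SIGMA s:?S. ?Q s)"
  proof -
    have "s \<circ> inv p permutes {1..n}" if "s permutes {1..n}" "p permutes {1..n}" for s p
      using that permutes_compose[OF permutes_inv] by blast
    then show ?thesis
      by (auto simp: plane_permutations_def diagonal_def perms_of_type_def)
  qed
  then have "card (\<Union>D\<in>perms_of_type n l. ?R D) = (\<Sum>s\<in>?S. card (?Q s))"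
    using card_SigmaI[of ?S ?Q] fin by simp
  also have "\<dots> = card ?S * card (typed_perms n k l)" using Q by simp
  also have "card (\<Union>D\<in>perms_of_type n l. ?R D) = (\<Sum>D\<in>perms_of_type n l. card (?R D))"
    using finl finP by (intro card_UN_disjoint) auto
  also have "\<dots> = (\<Sum>D\<in>perms_of_type n l. plane_count n k l)"
    using plane_count_eq by (intro sum.cong refl) (simp add: diagonal_count_def)
  finally show ?thesis by (simp add: cycle_type_count_def mult.commute)
qed

theorem corollary1:
  fixes n k :: nat and l :: "nat multiset"
  assumes "n \<ge> 1" and "k \<ge> 1"
    and "l \<in> number_partitions n"
    and "int (size l) < int n + 1 - int k"
  shows "real (plane_count n k l) =
    ((\<Sum>\<^sub>\<infinity>i\<in>{1..}. real ((k + 2 * i) choose (k - 1)) * real (plane_count n (k + 2 * i) l)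
          * real (cycle_type_count n l))
     + (\<Sum>\<^sub>\<infinity>i\<in>{1..}. \<Sum>m | m \<in> number_partitions n \<and> splits_part (2 * i + 1) m l.
          real (kappa m l) * real (plane_count n k m) * real (cycle_type_count n m)))
    / (real (cycle_type_count n l) * (real n + 1 - real k - real (size l)))"
proof -
  \<comment> \<open>The number of long cycles, a factor common to all terms. It is absorbed again by
    \<open>link\<close> at the end and never divided out.\<close>
  define M where "M = real (card {s. s permutes {1..n} \<and> cyclic_on s {1..n}})"
  have link: "real (plane_count n k' m) * real (cycle_type_count n m) = M * real (card (typed_perms n k' m))"
    for k' m
    using plane_count_typed_perms[OF assms(1), of k' m] unfolding M_def by (simp flip: of_nat_mult)
  let ?a = "\<lambda>i. real ((k + 2 * i) choose (k - 1)) * real (plane_count n (k + 2 * i) l)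
      * real (cycle_type_count n l)"
  let ?b = "\<lambda>i. \<Sum>m | m \<in> number_partitions n \<and> splits_part (2 * i + 1) m l.
      real (kappa m l) * real (plane_count n k m) * real (cycle_type_count n m)"
  \<comment> \<open>For \<open>i > n\<close> a permutation would need \<open>k + 2 * i > n\<close>
    cycles.\<close>
  have "infsum ?a {1..} = infsum ?a {1..n}"
    by (rule infsum_cong_neutral) (auto simp: plane_count_eq_0)
  also have "\<dots> = M * (\<Sum>i\<in>{1..n}. real (((k + 2 * i) choose (k - 1)) * card (typed_perms n (k + 2 * i) l)))"
    by (simp add: mult.assoc link sum_distrib_left) (simp add: mult.left_commute)
  finally have a: "infsum ?a {1..} = M * (\<Sum>i\<in>{1..n}.
      real (((k + 2 * i) choose (k - 1)) * card (typed_perms n (k + 2 * i) l)))" .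
  \<comment> \<open>A part of \<open>l\<close> is at most \<open>n\<close>, so it has no splitting
    into more than \<open>n\<close> non-zero parts.\<close>
  have empty: "{m. m \<in> number_partitions n \<and> splits_part (2 * i + 1) m l} = {}" if "n < i" for i
    using splits_part_le[OF _ assms(3), of "2 * i + 1"] that by fastforce
  have "infsum ?b {1..} = infsum ?b {1..n}"
    by (rule infsum_cong_neutral) (use empty in \<open>auto simp del: Collect_empty_eq\<close>)
  also have "\<dots> = M * (\<Sum>i\<in>{1..n}. \<Sum>m | m \<in> number_partitions n \<and> splits_part (2 * i + 1) m l.
      real (kappa m l * card (typed_perms n k m)))"
    by (simp add: mult.assoc link sum_distrib_left) (simp add: mult.left_commute)
  finally have b: "infsum ?b {1..} = M * (\<Sum>i\<in>{1..n}.
      \<Sum>m | m \<in> number_partitions n \<and> splits_part (2 * i + 1) m l. real (kappa m l * card (typed_perms n k m)))" .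
  let ?d = "real n + 1 - real k - real (size l)"
  \<comment> \<open>This is \<open>typed_perms_recurrence\<close> multiplied by
    \<open>M\<close>.\<close>
  have "infsum ?a {1..} + infsum ?b {1..} + M * real ((k + size l) * card (typed_perms n k l))
      = M * real ((n + 1) * card (typed_perms n k l))"
    unfolding a b typed_perms_recurrence[OF assms(1,2), of l, symmetric]
    by (simp only: of_nat_add of_nat_sum distrib_left)
  then have "infsum ?a {1..} + infsum ?b {1..} = M * real (card (typed_perms n k l)) * ?d"
    by (simp add: algebra_simps)
  also have "\<dots> = real (plane_count n k l) * (real (cycle_type_count n l) * ?d)"
    by (simp add: link[symmetric])
  finally have eq: "infsum ?a {1..} + infsum ?b {1..}
      = real (plane_count n k l) * (real (cycle_type_count n l) * ?d)" .
  \<comment> \<open>It remains to divide: some permutation has type \<open>l\<close>, and the bound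
    on \<open>size l\<close> makes \<open>?d\<close> non-zero.\<close>
  have "finite (perms_of_type n l)"
    by (rule finite_subset[OF _ finite_permutations[of "{1..n}"]]) (auto simp: perms_of_type_def)
  then have "real (cycle_type_count n l) \<noteq> 0"
    using perms_of_type_nonempty[OF assms(3)] by (simp add: cycle_type_count_def)
  moreover have "?d \<noteq> 0" using assms(4) by linarith
  ultimately show ?thesis unfolding eq by simp
qed

end
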